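(* Let $0<p<2$ and $0<q<\infty$. Suppose that $(u_k)_{k\ge1}$ is a sequence in $L_{p,q}(0,1)$ and that there is $u\in L_{p,q}(0,1)$ with $u_k^*\le u^*$ for every $k$. Fix $r>\max\{p,q,2\}$. Then $$\left(\operatorname{Ave}_{\varepsilon_k=\pm1}\left\|\sum_{k=1}^n\varepsilon_k u_k\right\|_{p,q}^{r}\right)^{1/r}=o(n^{1/p})\qquad(n\to\infty).$$
   Context: For a measurable scalar function $f$ on $(0,1)$ with Lebesgue measure $m$, $f^*(t)=\inf\{\lambda>0:m\{|f|>\lambda\}\le t\}$, $t>0$, is its decreasing rearrangement. For $0<p,q<\infty$, $L_{p,q}(0,1)$ is the space of measurable $f$ on $(0,1)$ with $\|f\|_{p,q}=\left(\int_0^\infty [t^{1/p}f^*(t)]^q\,\frac{dt}{t}\right)^{1/q}<\infty$. $\operatorname{Ave}_{\varepsilon_k=\pm1}$ denotes the arithmetic mean over all $2^n$ choices of signs $(\varepsilon_1,\dots,\varepsilon_n)\in\{-1,1\}^n$. *)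

theory Defs
  imports "HOL-Analysis.Analysis" "HOL-Library.Landau_Symbols"
begin

text \<open>Functions on \<open>(0,1)\<close> are total functions on the reals of which only the values on
  \<open>{0<..<1}\<close> matter.\<close>

abbreviation unit_measure :: "real measure" where
  "unit_measure \<equiv> lebesgue_on {0<..<1}"

text \<open>The set below is nonempty for measurable \<open>f\<close> and \<open>t > 0\<close>, because the measure of
  \<open>{\<bar>f\<bar> > s}\<close> tends to 0 as \<open>s\<close> tends to infinity; so the real infimum is the intended one.\<close>

definition decreasing_rearrangement :: "(real \<Rightarrow> 'a::real_normed_vector) \<Rightarrow> real \<Rightarrow> real" where
  "decreasing_rearrangement f t =
     Inf {s. s > 0 \<and> measure unit_measure {x \<in> {0<..<1}. norm (f x) > s} \<le> t}"

definition lorentz_integral ::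
    "real \<Rightarrow> real \<Rightarrow> (real \<Rightarrow> 'a::real_normed_vector) \<Rightarrow> ennreal" where
  "lorentz_integral p q f =
     (\<integral>\<^sup>+t\<in>{0<..}. ennreal ((t powr (1 / p) * decreasing_rearrangement f t) powr q / t) \<partial>lborel)"

definition lorentz_space ::
    "real \<Rightarrow> real \<Rightarrow> (real \<Rightarrow> 'a::real_normed_vector) set" where
  "lorentz_space p q =
     {f \<in> borel_measurable unit_measure. lorentz_integral p q f < \<infinity>}"

text \<open>The value is meaningful for members of \<open>lorentz_space p q\<close> only (\<open>enn2real\<close> sends
  \<open>\<infinity>\<close> to 0). That space is closed under addition and scalar multiplication.\<close>

definition lorentz_norm ::
    "real \<Rightarrow> real \<Rightarrow> (real \<Rightarrow> 'a::real_normed_vector) \<Rightarrow> real" where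
  "lorentz_norm p q f = enn2real (lorentz_integral p q f) powr (1 / q)"

definition sign_average :: "nat \<Rightarrow> ((nat \<Rightarrow> real) \<Rightarrow> real) \<Rightarrow> real" where
  "sign_average n F = (\<Sum>\<epsilon> \<in> {1..n} \<rightarrow>\<^sub>E {-1, 1}. F \<epsilon>) / 2 ^ n"

end

(* Fix a time t and cut every u_k at height v^*(t/2n): the discarded parts live on a set of measure
   at most t/2, and the square function of the remaining parts is controlled, by Khinchine's
   inequality and Minkowski's inequality in L_{r/2}, by the dyadic sum of 2^j v^*(2^j t/2n)^2.
   Since p < 2, a dyadic Hardy inequality absorbs this sum into the L_{p,q} integral of v
   (Minkowski in L_{r/q} moves the average inside the integral). After rescaling, only the
   integral of v over (0, 2^j/2n) enters with geometric weight rho^j, so dividing by n^(1/p) leaves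
   a quantity that tends to 0 by dominated convergence. *)
theory Submission
  imports Defs
begin

section \<open>Khinchine's and Minkowski's inequalities\<close>

text \<open>\<open>lorentz_norm\<close> need not satisfy the triangle inequality here, nor is the
  rearrangement subadditive, so norms are never split: for each t the rearrangement of the signed
  sum is bounded, and only then is the bound integrated. The u_k are not dominated pointwise by v
  either; only the measures of their level sets are controlled. This suffices because, after
  Khinchine's inequality, only the integral of the sum of squares enters. The conditions q < r and 2
  < r make the Minkowski exponents r/q and r/2 exceed 1. The order n^(1/p) comes from the
  substitution s = 2^j t/(2n). The gain from O to o comes from the finite measure of the interval:
  the rearrangement of the sum vanishes for t >= 1, so for fixed j only s < 2^j/(2n) contributes.
  The ratio \<rho> weighs the growth 2^(jq/2) of the dyadic sum, enlarged by a Hardy weight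
  \<theta>^(jq/2), against the decay 2^(-jq/p) due to the substitution; p < 2 leaves room for some
  \<theta> > 1.\<close>

lemma tanh_real_le: "tanh x \<le> x" if "0 \<le> x" for x :: real
proof -
  have "0 - tanh 0 \<le> x - tanh x"
  proof (rule DERIV_nonneg_imp_nondecreasing[OF that])
    fix y :: real
    have "((\<lambda>x. x - tanh x) has_real_derivative 1 - (1 - tanh y ^ 2)) (at y)"
      by (rule derivative_eq_intros refl | simp)+
    then show "\<exists>z. ((\<lambda>x. x - tanh x) has_real_derivative z) (at y) \<and> 0 \<le> z"
      by fastforce
  qed
  then show ?thesis by simp
qed

text \<open>The sub-Gaussian bound for one random sign: \<open>x\<^sup>2 / 2 - ln (cosh x)\<close>
  vanishes at 0 and has derivative x - tanh x >= 0 for x >= 0; evenness covers negative x.\<close>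

lemma cosh_real_le_exp_square: "cosh x \<le> exp (x\<^sup>2 / 2)" for x :: real
proof -
  have *: "cosh y \<le> exp (y\<^sup>2 / 2)" if "0 \<le> y" for y :: real
  proof -
    have "0\<^sup>2 / 2 - ln (cosh 0) \<le> y\<^sup>2 / 2 - ln (cosh y)"
    proof (rule DERIV_nonneg_imp_nondecreasing[OF that])
      fix z :: real assume "0 \<le> z"
      have "((\<lambda>x. x\<^sup>2 / 2 - ln (cosh x)) has_real_derivative z - tanh z) (at z)"
        by (rule derivative_eq_intros refl cosh_real_pos | simp add: tanh_def)+
      then show "\<exists>d. ((\<lambda>x. x\<^sup>2 / 2 - ln (cosh x)) has_real_derivative d) (at z) \<and> 0 \<le> d"
        using tanh_real_le[OF \<open>0 \<le> z\<close>] by force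
    qed
    then have "ln (cosh y) \<le> y\<^sup>2 / 2" by simp
    then show ?thesis
      by (metis cosh_real_pos exp_le_cancel_iff exp_ln)
  qed
  show ?thesis
    using *[of "\<bar>x\<bar>"] by (cases "0 \<le> x") auto
qed

text \<open>Put x = z/r in x <= exp x and raise to the power r. Exponential moments thus control
  moments of every order.\<close>

lemma powr_le_exp:
  fixes r z :: real
  assumes "0 < r" "0 \<le> z"
  shows "z powr r \<le> r powr r * exp z"
proof -
  have "z / r \<le> exp (z / r)"
    using exp_ge_add_one_self[of "z / r"] by linarith
  then have "(z / r) powr r \<le> exp (z / r) powr r"
    using assms by (intro powr_mono2) auto
  then show ?thesis
    using assms by (simp add: powr_divide field_simps exp_powr_real)
qed

lemma finite_signs: "finite ({1..n} \<rightarrow>\<^sub>E {-1, 1::real})" for n :: nat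
  by (intro finite_PiE) auto

text \<open>Independence of the signs: the sum of a product over all sign vectors is the product of
  the sums over {-1, 1}, each equal to 2 cosh (a k).\<close>

lemma sum_exp_signs_le:
  fixes a :: "nat \<Rightarrow> real"
  shows "(\<Sum>\<epsilon>\<in>{1..n} \<rightarrow>\<^sub>E {-1, 1}. exp (\<Sum>k=1..n. \<epsilon> k * a k))
    \<le> 2 ^ n * exp ((\<Sum>k=1..n. (a k)\<^sup>2) / 2)"
proof -
  have "(\<Sum>\<epsilon>\<in>{1..n} \<rightarrow>\<^sub>E {-1, 1}. exp (\<Sum>k=1..n. \<epsilon> k * a k))
      = (\<Sum>\<epsilon>\<in>{1..n} \<rightarrow>\<^sub>E {-1, 1}. \<Prod>k=1..n. exp (\<epsilon> k * a k))"
    by (simp add: exp_sum)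
  also have "\<dots> = (\<Prod>k=1..n. \<Sum>e\<in>{-1, 1}. exp (e * a k))"
    by (rule prod_sum_PiE[symmetric]) auto
  also have "\<dots> = (\<Prod>k=1..n. 2 * cosh (a k))"
    by (intro prod.cong) (auto simp: cosh_def)
  also have "\<dots> \<le> (\<Prod>k=1..n. 2 * exp ((a k)\<^sup>2 / 2))"
    by (intro prod_mono) (auto simp: cosh_real_le_exp_square)
  also have "\<dots> = 2 ^ n * exp ((\<Sum>k=1..n. (a k)\<^sup>2) / 2)"
    by (simp add: prod.distrib exp_sum sum_divide_distrib)
  finally show ?thesis .
qed

text \<open>In the constant, 2 comes from exp |T| <= exp T + exp (-T), \<open>exp 1\<close> from
  rounding up exp (1/2), and r^r from \<open>powr_le_exp\<close>.\<close>

lemma khinchine_normalized: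
  fixes a :: "nat \<Rightarrow> real"
  assumes "0 < r" "(\<Sum>k=1..n. (a k)\<^sup>2) \<le> 1"
  shows "(\<Sum>\<epsilon>\<in>{1..n} \<rightarrow>\<^sub>E {-1, 1}. \<bar>\<Sum>k=1..n. \<epsilon> k * a k\<bar> powr r) \<le> 2 ^ n * (2 * exp 1 * r powr r)"
proof -
  let ?E = "{1..n} \<rightarrow>\<^sub>E {-1, 1::real}"
  have *: "(\<Sum>\<epsilon>\<in>?E. exp (\<Sum>k=1..n. \<epsilon> k * b k)) \<le> 2 ^ n * exp 1"
    if "(\<Sum>k=1..n. (b k)\<^sup>2) \<le> 1" for b
    using sum_exp_signs_le[where n = n and a = b] that
    by (smt (verit) exp_le_cancel_iff field_sum_of_halves mult_left_mono sum_nonneg zero_le_power zero_le_power2)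
  have "(\<Sum>\<epsilon>\<in>?E. \<bar>\<Sum>k=1..n. \<epsilon> k * a k\<bar> powr r)
      \<le> (\<Sum>\<epsilon>\<in>?E. r powr r * (exp (\<Sum>k=1..n. \<epsilon> k * a k) + exp (\<Sum>k=1..n. \<epsilon> k * - a k)))"
  proof (rule sum_mono)
    fix \<epsilon>
    let ?T = "\<Sum>k=1..n. \<epsilon> k * a k"
    have "\<bar>?T\<bar> powr r \<le> r powr r * exp \<bar>?T\<bar>"
      using assms by (intro powr_le_exp) auto
    also have "\<dots> \<le> r powr r * (exp ?T + exp (- ?T))"
      by (intro mult_left_mono) (auto simp: abs_if)
    finally show "\<bar>?T\<bar> powr r \<le> r powr r * (exp ?T + exp (\<Sum>k=1..n. \<epsilon> k * - a k))"
      by (simp add: sum_negf)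
  qed
  also have "\<dots> = r powr r * ((\<Sum>\<epsilon>\<in>?E. exp (\<Sum>k=1..n. \<epsilon> k * a k)) + (\<Sum>\<epsilon>\<in>?E. exp (\<Sum>k=1..n. \<epsilon> k * - a k)))"
    by (simp add: sum.distrib flip: sum_distrib_left)
  also have "\<dots> \<le> r powr r * (2 ^ n * exp 1 + 2 ^ n * exp 1)"
    using assms by (intro mult_left_mono add_mono *) auto
  finally show ?thesis by (simp add: algebra_simps)
qed

lemma khinchine_real:
  fixes a :: "nat \<Rightarrow> real"
  assumes "0 < r"
  shows "(\<Sum>\<epsilon>\<in>{1..n} \<rightarrow>\<^sub>E {-1, 1}. \<bar>\<Sum>k=1..n. \<epsilon> k * a k\<bar> powr r)
    \<le> 2 ^ n * (2 * exp 1 * r powr r) * (\<Sum>k=1..n. (a k)\<^sup>2) powr (r / 2)"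
proof -
  define V where "V = (\<Sum>k=1..n. (a k)\<^sup>2)"
  have V: "0 \<le> V" by (simp add: V_def sum_nonneg)
  show ?thesis
  proof (cases "V = 0")
    case True
    then have "\<And>k. k \<in> {1..n} \<Longrightarrow> a k = 0"
      unfolding V_def by (subst (asm) sum_nonneg_eq_0_iff) auto
    then show ?thesis by simp
  next
    case False
    \<comment> \<open>Homogeneity reduces to square sum 1; V = 0 was split off because of this
      division.\<close>
    let ?b = "\<lambda>k. a k / sqrt V"
    have "(\<Sum>k=1..n. (?b k)\<^sup>2) = 1"
      using False V by (simp add: power_divide V_def flip: sum_divide_distrib)
    then have "(\<Sum>\<epsilon>\<in>{1..n} \<rightarrow>\<^sub>E {-1, 1}. \<bar>\<Sum>k=1..n. \<epsilon> k * ?b k\<bar> powr r) \<le> 2 ^ n * (2 * exp 1 * r powr r)"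
      using assms by (intro khinchine_normalized) auto
    moreover have "\<bar>\<Sum>k=1..n. \<epsilon> k * ?b k\<bar> powr r
        = \<bar>\<Sum>k=1..n. \<epsilon> k * a k\<bar> powr r / V powr (r / 2)" for \<epsilon>
    proof -
      have "sqrt V powr r = V powr (r / 2)"
        using V by (simp add: powr_half_sqrt[symmetric] powr_powr)
      then show ?thesis
        using V by (simp add: powr_divide abs_divide flip: sum_divide_distrib)
    qed
    ultimately have "(\<Sum>\<epsilon>\<in>{1..n} \<rightarrow>\<^sub>E {-1, 1}. \<bar>\<Sum>k=1..n. \<epsilon> k * a k\<bar> powr r) / V powr (r / 2)
        \<le> 2 ^ n * (2 * exp 1 * r powr r)"
      by (simp only: sum_divide_distrib)
    then show ?thesis
      using V False unfolding V_def[symmetric] by (simp add: divide_le_eq)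
  qed
qed

text \<open>Reduction to the scalar case by coordinates. C is chosen before n, as an asymptotic
  statement in n requires.\<close>

lemma khinchine_euclidean:
  fixes r :: real
  assumes "0 < r"
  shows "\<exists>C>0. \<forall>n (x :: nat \<Rightarrow> 'a::euclidean_space).
    (\<Sum>\<epsilon>\<in>{1..n} \<rightarrow>\<^sub>E {-1, 1}. norm (\<Sum>k=1..n. \<epsilon> k *\<^sub>R x k) powr r)
      \<le> 2 ^ n * (C * (\<Sum>k=1..n. (norm (x k))\<^sup>2) powr (r / 2))"
proof (intro exI conjI allI)
  let ?d = "real DIM('a)"
  define K where "K = 2 * exp 1 * r powr r"
  have K: "0 < K" using assms by (simp add: K_def)
  show "0 < ?d powr r * ?d * K"
    using K by simp
  fix n :: nat and x :: "nat \<Rightarrow> 'a"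
  let ?E = "{1..n} \<rightarrow>\<^sub>E {-1, 1::real}"
  define V where "V = (\<Sum>k=1..n. (norm (x k))\<^sup>2)"
  have "norm y powr r \<le> ?d powr r * (\<Sum>b\<in>Basis. \<bar>y \<bullet> b\<bar> powr r)" for y :: 'a
  proof -
    \<comment> \<open>Comparison with the largest coordinate bounds the power of a sum by a sum of
      powers for every r > 0 at once, without convexity.\<close>
    obtain b where b: "b \<in> Basis" "\<And>c. c \<in> Basis \<Longrightarrow> \<bar>y \<bullet> c\<bar> \<le> \<bar>y \<bullet> b\<bar>"
    proof -
      let ?f = "\<lambda>c. \<bar>y \<bullet> c\<bar>"
      have "Max (?f ` Basis) \<in> ?f ` Basis" by (intro Max_in) auto
      then obtain b where "Max (?f ` Basis) = ?f b" "b \<in> Basis" by (rule imageE)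
      then show ?thesis using that[of b] by (metis Max_ge finite_Basis finite_imageI imageI)
    qed
    have "norm y \<le> (\<Sum>c\<in>Basis. \<bar>y \<bullet> c\<bar>)" by (rule norm_le_l1)
    also have "\<dots> \<le> ?d * \<bar>y \<bullet> b\<bar>"
      using b(2) by (intro sum_bounded_above) auto
    finally have "norm y powr r \<le> (?d * \<bar>y \<bullet> b\<bar>) powr r"
      using assms by (intro powr_mono2) auto
    also have "\<dots> = ?d powr r * \<bar>y \<bullet> b\<bar> powr r"
      by (simp add: powr_mult)
    also have "\<dots> \<le> ?d powr r * (\<Sum>b\<in>Basis. \<bar>y \<bullet> b\<bar> powr r)"
      using b by (intro mult_left_mono member_le_sum) auto
    finally show ?thesis .
  qed
  then have "(\<Sum>\<epsilon>\<in>?E. norm (\<Sum>k=1..n. \<epsilon> k *\<^sub>R x k) powr r)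
      \<le> (\<Sum>\<epsilon>\<in>?E. ?d powr r * (\<Sum>b\<in>Basis. \<bar>(\<Sum>k=1..n. \<epsilon> k *\<^sub>R x k) \<bullet> b\<bar> powr r))"
    by (intro sum_mono)
  also have "\<dots> = ?d powr r * (\<Sum>b\<in>Basis. \<Sum>\<epsilon>\<in>?E. \<bar>\<Sum>k=1..n. \<epsilon> k * (x k \<bullet> b)\<bar> powr r)"
    by (subst sum.swap) (simp add: sum_distrib_left inner_sum_left)
  also have "\<dots> \<le> ?d powr r * (\<Sum>b\<in>(Basis::'a set). 2 ^ n * K * V powr (r / 2))"
  proof (intro mult_left_mono sum_mono)
    fix b :: 'a assume b: "b \<in> Basis"
    have "(\<Sum>\<epsilon>\<in>?E. \<bar>\<Sum>k=1..n. \<epsilon> k * (x k \<bullet> b)\<bar> powr r)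
        \<le> 2 ^ n * K * (\<Sum>k=1..n. (x k \<bullet> b)\<^sup>2) powr (r / 2)"
      unfolding K_def by (rule khinchine_real[OF assms])
    also have "\<dots> \<le> 2 ^ n * K * V powr (r / 2)"
      unfolding V_def
      using assms K Basis_le_norm[OF b]
      by (intro mult_left_mono powr_mono2 sum_mono sum_nonneg) (auto simp: abs_le_square_iff[symmetric])
    finally show "(\<Sum>\<epsilon>\<in>?E. \<bar>\<Sum>k=1..n. \<epsilon> k * (x k \<bullet> b)\<bar> powr r) \<le> 2 ^ n * K * V powr (r / 2)" .
  qed simp
  also have "\<dots> = 2 ^ n * ((?d powr r * ?d * K) * V powr (r / 2))"
    by simp
  finally show "(\<Sum>\<epsilon>\<in>?E. norm (\<Sum>k=1..n. \<epsilon> k *\<^sub>R x k) powr r)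
      \<le> 2 ^ n * ((?d powr r * ?d * K) * (\<Sum>k=1..n. (norm (x k))\<^sup>2) powr (r / 2))"
    by (simp add: V_def)
qed

section \<open>Hoelder's and Minkowski's inequalities for finite families\<close>

text \<open>Exponents s/(s-1) and s, by Young's inequality for the normalised terms. The factor
  a^(s-1) is what arises when I^s is split as I^(s-1) I in the proof of Minkowski's
  inequality.\<close>

lemma sum_powr_le_Holder:
  fixes a b :: "'i \<Rightarrow> real"
  assumes "finite E" "1 \<le> s" "\<And>e. e \<in> E \<Longrightarrow> 0 \<le> a e" "\<And>e. e \<in> E \<Longrightarrow> 0 \<le> b e"
    and "0 \<le> B" "(\<Sum>e\<in>E. b e powr s) \<le> B powr s"
  shows "(\<Sum>e\<in>E. a e powr (s - 1) * b e) \<le> (\<Sum>e\<in>E. a e powr s) powr (1 - 1 / s) * B"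
proof (cases "(\<Sum>e\<in>E. a e powr s) = 0 \<or> B = 0")
  case True
  then consider "(\<Sum>e\<in>E. a e powr s) = 0" | "(\<Sum>e\<in>E. b e powr s) = 0"
    using assms by (force simp: sum_nonneg intro: antisym)
  \<comment> \<open>\<open>0 powr (s - 1)\<close> is 0 also for s = 1, so it suffices that all
    \<open>a e\<close> vanish.\<close>
  then have "(\<Sum>e\<in>E. a e powr (s - 1) * b e) = 0"
    by cases (use assms in \<open>auto simp: sum_nonneg_eq_0_iff\<close>)
  then show ?thesis using assms by simp
next
  case False
  define A where "A = (\<Sum>e\<in>E. a e powr s)"
  have A: "0 < A" using False by (simp add: A_def sum_nonneg order_less_le)
  have B: "0 < B" using False assms by simp
  define C where "C = A powr (1 - 1 / s) * B"
  have C: "0 < C" using A B by (simp add: C_def)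
  have "a e powr (s - 1) * b e / C \<le> (1 - 1 / s) * (a e powr s / A) + 1 / s * (b e powr s / B powr s)"
    if "e \<in> E" for e
  proof -
    have "(a e powr s / A) powr (1 - 1 / s) * (b e powr s / B powr s) powr (1 / s)
        \<le> (1 - 1 / s) * (a e powr s / A) + 1 / s * (b e powr s / B powr s)"
    proof (cases "a e = 0 \<or> b e = 0")
      case True
      then show ?thesis using assms A by auto
    next
      case False
      then show ?thesis
        using assms A B that by (intro Youngs_inequality_0) auto
    qed
    moreover have "(a e powr s / A) powr (1 - 1 / s) = a e powr (s - 1) / A powr (1 - 1 / s)"
      using assms A by (simp add: powr_divide powr_powr algebra_simps)
    moreover have "(b e powr s / B powr s) powr (1 / s) = b e / B"
      using assms B that by (simp add: powr_divide powr_powr)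
    ultimately show ?thesis by (simp add: C_def)
  qed
  then have "(\<Sum>e\<in>E. a e powr (s - 1) * b e / C)
      \<le> (\<Sum>e\<in>E. (1 - 1 / s) * (a e powr s / A) + 1 / s * (b e powr s / B powr s))"
    by (rule sum_mono)
  also have "\<dots> = (1 - 1 / s) * (A / A) + 1 / s * ((\<Sum>e\<in>E. b e powr s) / B powr s)"
    by (simp add: sum.distrib A_def flip: sum_distrib_left sum_divide_distrib)
  also have "\<dots> \<le> (1 - 1 / s) * 1 + 1 / s * 1"
    using assms A B by (intro add_mono mult_left_mono) auto
  finally have "(\<Sum>e\<in>E. a e powr (s - 1) * b e) / C \<le> 1"
    by (simp add: sum_divide_distrib)
  then show ?thesis
    using C by (simp add: C_def A_def)
qed

text \<open>Duality: A = \<Sum> I^s is the integral of \<Sum> I^(s-1) F; Hoelder's inequality under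
  the integral bounds it by A^(1-1/s) c K, and A^(1-1/s) is cancelled. The majorant W N^s replaces
  the inner sum of powers, so only N has to be integrated.\<close>

lemma Minkowski_powr_sum:
  fixes F :: "'i \<Rightarrow> 'x \<Rightarrow> real"
  assumes E: "finite E" and s: "1 \<le> s"
    and F [measurable]: "\<And>e. e \<in> E \<Longrightarrow> F e \<in> borel_measurable M"
    and F0: "\<And>e x. e \<in> E \<Longrightarrow> x \<in> space M \<Longrightarrow> 0 \<le> F e x"
    and N [measurable]: "N \<in> borel_measurable M"
    and N0: "\<And>x. x \<in> space M \<Longrightarrow> 0 \<le> N x"
    and W: "0 \<le> W"
    and le: "\<And>x. x \<in> space M \<Longrightarrow> (\<Sum>e\<in>E. F e x powr s) \<le> W * N x powr s"
    and K: "0 \<le> K" "(\<integral>\<^sup>+x. ennreal (N x) \<partial>M) \<le> ennreal K"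
  shows "(\<Sum>e\<in>E. enn2real (\<integral>\<^sup>+x. ennreal (F e x) \<partial>M) powr s) \<le> W * K powr s"
proof -
  define c where "c = W powr (1 / s)"
  have c: "0 \<le> c" "c powr s = W"
    using s W by (auto simp: c_def powr_powr)
  have cN: "(\<Sum>e\<in>E. F e x powr s) \<le> (c * N x) powr s" if "x \<in> space M" for x
    using le[OF that] N0[OF that] c by (simp add: powr_mult)
  have FcN: "F e x \<le> c * N x" if "e \<in> E" "x \<in> space M" for e x
  proof -
    have "F e x powr s \<le> (\<Sum>e\<in>E. F e x powr s)"
      using E that by (intro member_le_sum) auto
    then have "F e x powr s \<le> (c * N x) powr s"
      using cN[OF that(2)] by simp
    then show ?thesis
      using s c(1) N0[OF that(2)] F0[OF that] by (meson powr_less_mono2 not_le order_less_le_trans zero_less_one mult_nonneg_nonneg)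
  qed
  have intN: "(\<integral>\<^sup>+x. ennreal (c * N x) \<partial>M) \<le> ennreal (c * K)"
  proof -
    have "(\<integral>\<^sup>+x. ennreal (c * N x) \<partial>M) = (\<integral>\<^sup>+x. ennreal c * ennreal (N x) \<partial>M)"
      using c by (intro nn_integral_cong) (auto simp: ennreal_mult' N0)
    also have "\<dots> = ennreal c * (\<integral>\<^sup>+x. ennreal (N x) \<partial>M)"
      by (intro nn_integral_cmult) auto
    also have "\<dots> \<le> ennreal c * ennreal K"
      using K by (intro mult_left_mono) auto
    finally show ?thesis using c K by (simp add: ennreal_mult)
  qed
  define I where "I e = enn2real (\<integral>\<^sup>+x. ennreal (F e x) \<partial>M)" for e
  \<comment> \<open>Finiteness comes first: \<open>enn2real\<close> sends infinity to 0, so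
    \<open>I e\<close> is the true integral only because \<open>F e\<close> lies below the
    integrable c N.\<close>
  have I: "(\<integral>\<^sup>+x. ennreal (F e x) \<partial>M) = ennreal (I e)" if "e \<in> E" for e
  proof -
    have "(\<integral>\<^sup>+x. ennreal (F e x) \<partial>M) \<le> (\<integral>\<^sup>+x. ennreal (c * N x) \<partial>M)"
      using FcN that by (intro nn_integral_mono ennreal_leI) auto
    then have "(\<integral>\<^sup>+x. ennreal (F e x) \<partial>M) < top"
      using intN by (meson ennreal_less_top order_le_less_trans)
    then show ?thesis by (simp add: I_def)
  qed
  have I0: "0 \<le> I e" for e by (simp add: I_def)
  define A where "A = (\<Sum>e\<in>E. I e powr s)"
  have A0: "0 \<le> A" by (simp add: A_def sum_nonneg)
  have "ennreal A = (\<Sum>e\<in>E. ennreal (I e powr (s - 1)) * (\<integral>\<^sup>+x. ennreal (F e x) \<partial>M))"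
  proof -
    have "I e powr s = I e powr (s - 1) * I e" for e
      using I0[of e] by (cases "I e = 0") (auto simp: powr_diff)
    then show ?thesis
      unfolding A_def by (subst sum_ennreal[symmetric]) (auto simp: I I0 ennreal_mult intro!: sum.cong)
  qed
  also have "\<dots> = (\<integral>\<^sup>+x. (\<Sum>e\<in>E. ennreal (I e powr (s - 1)) * ennreal (F e x)) \<partial>M)"
    by (subst nn_integral_sum) (auto simp: nn_integral_cmult intro!: sum.cong)
  also have "\<dots> \<le> (\<integral>\<^sup>+x. ennreal (A powr (1 - 1 / s)) * ennreal (c * N x) \<partial>M)"
  proof (rule nn_integral_mono)
    fix x assume x: "x \<in> space M"
    have "(\<Sum>e\<in>E. I e powr (s - 1) * F e x) \<le> A powr (1 - 1 / s) * (c * N x)"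
      unfolding A_def
      using E s I0 F0 x c(1) N0 cN by (intro sum_powr_le_Holder) auto
    then show "(\<Sum>e\<in>E. ennreal (I e powr (s - 1)) * ennreal (F e x)) \<le> ennreal (A powr (1 - 1 / s)) * ennreal (c * N x)"
      using F0 x by (subst (asm) ennreal_le_iff[symmetric])
        (auto simp: c N0 ennreal_mult' sum_nonneg simp flip: sum_ennreal)
  qed
  also have "\<dots> = ennreal (A powr (1 - 1 / s)) * (\<integral>\<^sup>+x. ennreal (c * N x) \<partial>M)"
    by (intro nn_integral_cmult) auto
  also have "\<dots> \<le> ennreal (A powr (1 - 1 / s)) * ennreal (c * K)"
    using intN by (intro mult_left_mono) auto
  finally have A: "A \<le> A powr (1 - 1 / s) * (c * K)"
    using c K by (subst (asm) ennreal_mult'[symmetric]) (auto simp: ennreal_le_iff)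
  have "A \<le> (c * K) powr s"
  proof (cases "A = 0")
    case False
    with A0 have "0 < A" by simp
    then have "A powr (1 / s) \<le> c * K"
      using A by (simp add: powr_diff field_simps)
    then have "(A powr (1 / s)) powr s \<le> (c * K) powr s"
      using s by (intro powr_mono2) auto
    then show ?thesis using s A0 by (simp add: powr_powr)
  qed simp
  then show ?thesis
    using c K by (simp add: A_def I_def powr_mult)
qed

section \<open>Decreasing rearrangements\<close>

definition distribution :: "(real \<Rightarrow> 'a::real_normed_vector) \<Rightarrow> real \<Rightarrow> real" where
  "distribution f s = measure unit_measure {x \<in> {0<..<1}. s < norm (f x)}"

lemma decreasing_rearrangement_altdef:
  "decreasing_rearrangement f t = Inf {s. 0 < s \<and> distribution f s \<le> t}"
  by (simp add: decreasing_rearrangement_def distribution_def)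

interpretation unit_measure: finite_measure unit_measure
  by (rule finite_measure_lebesgue_on) simp

lemma space_unit_measure [simp]: "space unit_measure = {0<..<1}"
  by (simp add: space_restrict_space)

lemma measure_unit_measure_le_1: "measure unit_measure A \<le> 1"
proof -
  have "measure unit_measure A \<le> measure unit_measure (space unit_measure)"
    by (rule unit_measure.bounded_measure)
  also have "\<dots> = 1"
    by (simp add: measure_restrict_space)
  finally show ?thesis .
qed

lemma sets_norm_greater [measurable]:
  fixes f :: "real \<Rightarrow> 'a::real_normed_vector"
  assumes [measurable]: "f \<in> borel_measurable unit_measure"
  shows "{x \<in> {0<..<1}. s < norm (f x)} \<in> sets unit_measure"
proof -
  have "{x \<in> space unit_measure. s < norm (f x)} \<in> sets unit_measure"
    by measurable
  then show ?thesis by simp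
qed

lemma distribution_antimono:
  assumes "f \<in> borel_measurable unit_measure" "s \<le> s'"
  shows "distribution f s' \<le> distribution f s"
  unfolding distribution_def
  using assms by (intro unit_measure.finite_measure_mono sets_norm_greater) auto

lemma distribution_tendsto_0:
  assumes "f \<in> borel_measurable unit_measure"
  shows "(\<lambda>n. distribution f (real n)) \<longlonglongrightarrow> 0"
proof -
  have "(\<lambda>n. distribution f (real n)) \<longlonglongrightarrow> measure unit_measure (\<Inter>n. {x \<in> {0<..<1}. real n < norm (f x)})"
    unfolding distribution_def
    using assms
    by (intro unit_measure.finite_Lim_measure_decseq) (auto simp: decseq_def intro!: sets_norm_greater[simplified])
  also have "(\<Inter>n. {x \<in> {0<..<1::real}. real n < norm (f x)}) = {}"
  proof (intro equals0I)
    fix x assume x: "x \<in> (\<Inter>n. {x \<in> {0<..<1::real}. real n < norm (f x)})"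
    obtain n where "norm (f x) \<le> real n"
      using real_arch_simple by blast
    with x show False by (auto dest: spec[of _ n])
  qed
  finally show ?thesis by simp
qed

text \<open>The infimum of an empty set of reals is unspecified; nonnegativity and monotonicity of
  the rearrangement rest on this.\<close>

lemma ex_distribution_le:
  assumes "f \<in> borel_measurable unit_measure" "0 < t"
  shows "\<exists>s>0. distribution f s \<le> t"
proof -
  have "\<forall>\<^sub>F n in sequentially. distribution f (real n) < t"
    using distribution_tendsto_0[OF assms(1)] assms(2) by (rule order_tendstoD)
  then have "\<forall>\<^sub>F n in sequentially. distribution f (real n) < t \<and> 0 < n"
    using eventually_gt_at_top by (rule eventually_conj)
  then obtain n where "distribution f (real n) < t" "0 < n"
    using eventually_happens'[OF sequentially_bot] by blast
  then show ?thesis by (intro exI[of _ "real n"]) auto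
qed

lemma bdd_below_rearrangement_set: "bdd_below {s. 0 < s \<and> P s}" for P :: "real \<Rightarrow> bool"
  by (intro bdd_belowI[of _ 0]) auto

lemma decreasing_rearrangement_nonneg:
  assumes "f \<in> borel_measurable unit_measure" "0 < t"
  shows "0 \<le> decreasing_rearrangement f t"
  unfolding decreasing_rearrangement_altdef
  using ex_distribution_le[OF assms] by (intro cInf_greatest) auto

lemma decreasing_rearrangement_antimono:
  assumes "f \<in> borel_measurable unit_measure" "0 < t" "t \<le> t'"
  shows "decreasing_rearrangement f t' \<le> decreasing_rearrangement f t"
  unfolding decreasing_rearrangement_altdef
  using ex_distribution_le[OF assms(1,2)] assms(3)
  by (intro cInf_superset_mono bdd_below_rearrangement_set) auto

text \<open>The set behind the infimum contains only s > 0, while D may be 0; hence the passage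
  through D + e.\<close>

lemma decreasing_rearrangement_le:
  assumes "0 \<le> D" "\<And>s. D < s \<Longrightarrow> distribution f s \<le> t"
  shows "decreasing_rearrangement f t \<le> D"
proof (rule field_le_epsilon)
  fix e :: real assume "0 < e"
  then show "decreasing_rearrangement f t \<le> D + e"
    unfolding decreasing_rearrangement_altdef
    using assms by (intro cInf_lower bdd_below_rearrangement_set) auto
qed

text \<open>The interval has measure 1. This makes the dyadic sums below finite and confines the
  integration to t < 1.\<close>

lemma decreasing_rearrangement_eq_0:
  assumes "f \<in> borel_measurable unit_measure" "1 \<le> t"
  shows "decreasing_rearrangement f t = 0"
proof (rule antisym)
  show "decreasing_rearrangement f t \<le> 0"
    using assms(2) by (intro decreasing_rearrangement_le)
      (auto simp: distribution_def intro: order_trans[OF measure_unit_measure_le_1])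
qed (use assms in \<open>simp add: decreasing_rearrangement_nonneg\<close>)

text \<open>The infimum is attained up to right continuity: the sets where |f| exceeds d + 1/(n+1)
  increase to the set where it exceeds d, and the measure is continuous along them.\<close>

lemma distribution_decreasing_rearrangement:
  assumes "f \<in> borel_measurable unit_measure" "0 < t"
  shows "distribution f (decreasing_rearrangement f t) \<le> t"
proof -
  let ?d = "decreasing_rearrangement f t"
  have "(\<lambda>n. distribution f (?d + 1 / real (Suc n)))
      \<longlonglongrightarrow> measure unit_measure (\<Union>n. {x \<in> {0<..<1}. ?d + 1 / real (Suc n) < norm (f x)})"
    unfolding distribution_def
  proof (intro unit_measure.finite_Lim_measure_incseq)
    show "incseq (\<lambda>n. {x \<in> {0<..<1}. ?d + 1 / real (Suc n) < norm (f x)})"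
    proof (intro incseq_SucI subsetI)
      fix n x assume "x \<in> {x \<in> {0<..<1}. ?d + 1 / real (Suc n) < norm (f x)}"
      moreover have "1 / real (Suc (Suc n)) \<le> 1 / real (Suc n)"
        by (simp add: frac_le)
      ultimately show "x \<in> {x \<in> {0<..<1}. ?d + 1 / real (Suc (Suc n)) < norm (f x)}"
        by (auto simp del: of_nat_Suc)
    qed
  qed (use sets_norm_greater[OF assms(1)] in blast)
  moreover have "(\<Union>n. {x \<in> {0<..<1}. ?d + 1 / real (Suc n) < norm (f x)}) = {x \<in> {0<..<1}. ?d < norm (f x)}"
  proof (intro equalityI subsetI)
    fix x assume x: "x \<in> {x \<in> {0<..<1}. ?d < norm (f x)}"
    then obtain n where "1 / real (Suc n) < norm (f x) - ?d"
      using nat_approx_posE[of "norm (f x) - ?d"] by auto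
    with x show "x \<in> (\<Union>n. {x \<in> {0<..<1}. ?d + 1 / real (Suc n) < norm (f x)})"
      by (auto intro!: exI[of _ n])
  next
    fix x assume "x \<in> (\<Union>n. {x \<in> {0<..<1}. ?d + 1 / real (Suc n) < norm (f x)})"
    then obtain n where "x \<in> {0<..<1}" "?d + 1 / real (Suc n) < norm (f x)" by blast
    moreover have "0 < 1 / real (Suc n)" by simp
    ultimately have "?d < norm (f x)" by linarith
    with \<open>x \<in> {0<..<1}\<close> show "x \<in> {x \<in> {0<..<1}. ?d < norm (f x)}" by simp
  qed
  ultimately have "(\<lambda>n. distribution f (?d + 1 / real (Suc n))) \<longlonglongrightarrow> distribution f ?d"
    by (simp add: distribution_def)
  moreover have "distribution f (?d + 1 / real (Suc n)) \<le> t" for n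
  proof -
    have "Inf {s. 0 < s \<and> distribution f s \<le> t} < ?d + 1 / real (Suc n)"
      by (simp add: decreasing_rearrangement_altdef)
    then obtain s where "distribution f s \<le> t" "s < ?d + 1 / real (Suc n)"
      using ex_distribution_le[OF assms] by (subst (asm) cInf_less_iff) (auto intro: bdd_below_rearrangement_set)
    then show ?thesis
      using distribution_antimono[OF assms(1), of s "?d + 1 / real (Suc n)"] by linarith
  qed
  ultimately show ?thesis by (intro LIMSEQ_le_const2) auto
qed

text \<open>Measurability comes from monotonicity, which is available for t > 0 only; hence the
  indicator.\<close>

lemma borel_measurable_decreasing_rearrangement:
  assumes "f \<in> borel_measurable unit_measure"
  shows "(\<lambda>t. decreasing_rearrangement f t * indicator {0<..} t) \<in> borel_measurable borel"
proof -
  have "mono_on {0<..} (\<lambda>t. - decreasing_rearrangement f t)"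
    using assms by (auto intro!: mono_onI decreasing_rearrangement_antimono)
  then have "(\<lambda>t. - decreasing_rearrangement f t) \<in> borel_measurable (restrict_space borel {0<..})"
    by (rule borel_measurable_mono_on_fnc)
  then have "decreasing_rearrangement f \<in> borel_measurable (restrict_space borel {0<..})"
    by simp
  then show ?thesis
    by (subst (asm) borel_measurable_restrict_space_iff) (auto simp: mult.commute)
qed

section \<open>Dyadic sums and level sets\<close>

text \<open>Hardy's inequality in dyadic form: the weights \<open>\<theta> ^ j\<close> allow one argument for
  \<open>\<alpha> \<le> 1\<close> and \<open>\<alpha> \<ge> 1\<close>.\<close>

lemma sum_powr_le_weighted:
  fixes b :: "nat \<Rightarrow> real"
  assumes "1 < \<theta>" "0 < \<alpha>" "\<And>j. 0 \<le> b j"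
  shows "(\<Sum>j<J. b j) powr \<alpha> \<le> (\<theta> / (\<theta> - 1)) powr \<alpha> * (\<Sum>j<J. (\<theta> ^ j * b j) powr \<alpha>)"
proof -
  define B where "B = (\<Sum>j<J. (\<theta> ^ j * b j) powr \<alpha>)"
  have B: "0 \<le> B" by (simp add: B_def sum_nonneg)
  \<comment> \<open>Each weighted term is at most the whole sum B, so b decays geometrically; the
    geometric series gives the factor \<theta>/(\<theta> - 1) whatever the size of \<alpha>.\<close>
  have "b j \<le> B powr (1 / \<alpha>) * (1 / \<theta>) ^ j" if "j < J" for j
  proof -
    have "(\<theta> ^ j * b j) powr \<alpha> \<le> B"
      unfolding B_def using that by (intro member_le_sum) auto
    then have "((\<theta> ^ j * b j) powr \<alpha>) powr (1 / \<alpha>) \<le> B powr (1 / \<alpha>)"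
      using assms by (intro powr_mono2) auto
    then show ?thesis
      using assms by (simp add: powr_powr field_simps)
  qed
  then have "(\<Sum>j<J. b j) \<le> (\<Sum>j<J. B powr (1 / \<alpha>) * (1 / \<theta>) ^ j)"
    by (intro sum_mono) auto
  also have "\<dots> = B powr (1 / \<alpha>) * (\<Sum>j<J. (1 / \<theta>) ^ j)"
    by (simp add: sum_distrib_left)
  also have "(\<Sum>j<J. (1 / \<theta>) ^ j) \<le> (\<Sum>j. (1 / \<theta>) ^ j)"
    using assms by (intro sum_le_suminf summable_geometric) auto
  also have "(\<Sum>j. (1 / \<theta>) ^ j) = \<theta> / (\<theta> - 1)"
    using assms by (subst suminf_geometric) (auto simp: field_simps)
  finally have "(\<Sum>j<J. b j) \<le> B powr (1 / \<alpha>) * (\<theta> / (\<theta> - 1))"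
    by (simp add: mult_left_mono)
  then have "(\<Sum>j<J. b j) powr \<alpha> \<le> (B powr (1 / \<alpha>) * (\<theta> / (\<theta> - 1))) powr \<alpha>"
    using assms by (intro powr_mono2 sum_nonneg) auto
  also have "\<dots> = (\<theta> / (\<theta> - 1)) powr \<alpha> * B"
    using assms B by (subst powr_mult) (auto simp: powr_powr)
  finally show ?thesis by (simp add: B_def)
qed

text \<open>With \<open>l j\<close> a value of the rearrangement of the majorant, the measure of each level set is bounded by
  definition; this replaces the equimeasurability of a function and its rearrangement.\<close>

lemma square_le_sum_levels:
  fixes l :: "nat \<Rightarrow> real"
  assumes "0 \<le> z" "z \<le> l 0" "l J = 0"
  shows "z\<^sup>2 \<le> (\<Sum>j<J. (l j)\<^sup>2 * of_bool (l (Suc j) < z))"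
proof -
  \<comment> \<open>The alternative z <= l J keeps the induction going: if z exceeds
    \<open>l (Suc J)\<close>, the new summand (l J)^2 pays for it. At the end l J = 0 forces z =
    0.\<close>
  have "z\<^sup>2 \<le> (\<Sum>j<J. (l j)\<^sup>2 * of_bool (l (Suc j) < z)) \<or> z \<le> l J"
  proof (induction J)
    case (Suc J)
    show ?case
    proof (cases "l (Suc J) < z")
      case True
      have "0 \<le> (\<Sum>j<J. (l j)\<^sup>2 * of_bool (l (Suc j) < z))"
        by (intro sum_nonneg) auto
      then have "z\<^sup>2 \<le> (\<Sum>j<J. (l j)\<^sup>2 * of_bool (l (Suc j) < z)) + (l J)\<^sup>2"
        using Suc.IH power_mono[OF _ assms(1), of "l J" 2] zero_le_power2[of "l J"] by linarith
      with True show ?thesis by simp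
    qed simp
  qed (use assms in simp)
  moreover have "0 \<le> (\<Sum>j<J. (l j)\<^sup>2 * of_bool (l (Suc j) < z))"
    by (intro sum_nonneg) auto
  ultimately show ?thesis using assms by fastforce
qed

section \<open>Rearrangements of random sums\<close>

text \<open>The budget t is halved: t/2 for the set where f differs from g, and t/2 for Chebyshev's
  inequality applied to g, whose bound I/s^2 is at most t/2 once s^2 > 2I/t.\<close>

lemma decreasing_rearrangement_le_L2:
  fixes f g :: "real \<Rightarrow> 'a::euclidean_space"
  assumes f [measurable]: "f \<in> borel_measurable unit_measure"
    and g [measurable]: "g \<in> borel_measurable unit_measure"
    and t: "0 < t"
    and ne: "measure unit_measure {x \<in> {0<..<1}. f x \<noteq> g x} \<le> t / 2"
    and I: "0 \<le> I" "(\<integral>\<^sup>+x. ennreal ((norm (g x))\<^sup>2) \<partial>unit_measure) \<le> ennreal I"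
  shows "decreasing_rearrangement f t \<le> sqrt (2 * I / t)"
proof (rule decreasing_rearrangement_le)
  show "0 \<le> sqrt (2 * I / t)" using I t by simp
  fix s assume s: "sqrt (2 * I / t) < s"
  have s0: "0 < s" using I t s by (meson divide_nonneg_pos mult_nonneg_nonneg order_le_less_trans real_sqrt_ge_zero zero_le_numeral)
  have "2 * I / t < s\<^sup>2"
    using s s0 by (simp add: real_less_lsqrt sqrt_le_D real_sqrt_less_iff flip: real_sqrt_less_iff[of _ "s\<^sup>2"])
  then have I_le: "I / s\<^sup>2 \<le> t / 2"
    using t s0 by (simp add: field_simps)
  have "{x \<in> space unit_measure. f x \<noteq> g x} \<in> sets unit_measure"
    by measurable
  then have [measurable]: "{x \<in> {0<..<1}. f x \<noteq> g x} \<in> sets unit_measure" by simp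
  have "emeasure unit_measure {x \<in> {0<..<1}. s < norm (g x)}
      \<le> emeasure unit_measure {x \<in> space unit_measure. 1 \<le> ennreal (1 / s\<^sup>2) * ennreal ((norm (g x))\<^sup>2)}"
  proof (rule emeasure_mono)
    have "1 \<le> 1 / s\<^sup>2 * (norm (g x))\<^sup>2" if "s < norm (g x)" for x
      using that s0 power_mono[of s "norm (g x)" 2] by (simp add: field_simps)
    then show "{x \<in> {0<..<1}. s < norm (g x)} \<subseteq> {x \<in> space unit_measure. 1 \<le> ennreal (1 / s\<^sup>2) * ennreal ((norm (g x))\<^sup>2)}"
      by (auto simp flip: ennreal_mult')
  qed measurable
  also have "\<dots> \<le> ennreal (1 / s\<^sup>2) * (\<integral>\<^sup>+x. ennreal ((norm (g x))\<^sup>2) * indicator (space unit_measure) x \<partial>unit_measure)"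
    by (rule nn_integral_Markov_inequality) measurable
  also have "\<dots> = ennreal (1 / s\<^sup>2) * (\<integral>\<^sup>+x. ennreal ((norm (g x))\<^sup>2) \<partial>unit_measure)"
    by (intro arg_cong2[where f = "(*)"] refl nn_integral_cong) auto
  also have "\<dots> \<le> ennreal (1 / s\<^sup>2) * ennreal I"
    using I by (intro mult_left_mono) auto
  also have "\<dots> = ennreal (I / s\<^sup>2)"
    using I by (simp flip: ennreal_mult')
  finally have g_le: "measure unit_measure {x \<in> {0<..<1}. s < norm (g x)} \<le> I / s\<^sup>2"
    using I by (simp add: unit_measure.emeasure_eq_measure)
  have "distribution f s \<le> measure unit_measure ({x \<in> {0<..<1}. f x \<noteq> g x} \<union> {x \<in> {0<..<1}. s < norm (g x)})"
    unfolding distribution_def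
    by (rule unit_measure.finite_measure_mono) (auto intro!: sets.Un simp del: greaterThanLessThan_iff)
  also have "\<dots> \<le> measure unit_measure {x \<in> {0<..<1}. f x \<noteq> g x} + measure unit_measure {x \<in> {0<..<1}. s < norm (g x)}"
    by (rule measure_Un_le) measurable
  also have "\<dots> \<le> t"
    using ne g_le I_le by linarith
  finally show "distribution f s \<le> t" .
qed

text \<open>The l j are prescribed levels, later values of the rearrangement of v at 2^j t/(2n).
  Truncation at l 0 alters the sum on a set of measure at most n t/(2n), precisely the half budget
  of \<open>decreasing_rearrangement_le_L2\<close>.\<close>

lemma sum_signs_rearrangement_le:
  fixes u :: "nat \<Rightarrow> real \<Rightarrow> 'a::euclidean_space" and l :: "nat \<Rightarrow> real"
  assumes u: "\<And>k. k \<in> {1..n} \<Longrightarrow> u k \<in> borel_measurable unit_measure"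
    and n: "0 < n" and t: "0 < t" and r: "2 \<le> r"
    and l: "\<And>j. 0 \<le> l j" "l J = 0"
    and dist: "\<And>k j. k \<in> {1..n} \<Longrightarrow> distribution (u k) (l j) \<le> 2 ^ j * (t / (2 * real n))"
    and C: "0 < C" "\<And>x :: nat \<Rightarrow> 'a. (\<Sum>\<epsilon>\<in>{1..n} \<rightarrow>\<^sub>E {-1, 1}. norm (\<Sum>k=1..n. \<epsilon> k *\<^sub>R x k) powr r)
      \<le> 2 ^ n * (C * (\<Sum>k=1..n. (norm (x k))\<^sup>2) powr (r / 2))"
  shows "(\<Sum>\<epsilon>\<in>{1..n} \<rightarrow>\<^sub>E {-1, 1}. decreasing_rearrangement (\<lambda>x. \<Sum>k=1..n. \<epsilon> k *\<^sub>R u k x) t powr r)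
    \<le> 2 ^ n * C * (2 * (\<Sum>j<J. 2 ^ j * (l j)\<^sup>2)) powr (r / 2)"
proof -
  let ?E = "{1..n} \<rightarrow>\<^sub>E {-1, 1::real}"
  define a where "a k x = (if l 0 < norm (u k x) then 0 else u k x)" for k x
  define F where "F \<epsilon> x = (norm (\<Sum>k=1..n. \<epsilon> k *\<^sub>R a k x))\<^sup>2" for \<epsilon> x
  \<comment> \<open>A pointwise majorant of the sum of squares: |a k x|^2 is charged to the levels l
    j whose successor |u k x| exceeds.\<close>
  define N where "N x = (\<Sum>k=1..n. \<Sum>j<J. (l j)\<^sup>2 * of_bool (l (Suc j) < norm (u k x)))" for x
  \<comment> \<open>Bounds the integral of N: at level j the n functions contribute n 2^(j+1) t/(2n)
    = 2^j t. Passing to the level set of \<open>l (Suc j)\<close> costs the 2 that cancels the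
    denominator.\<close>
  define K where "K = t * (\<Sum>j<J. 2 ^ j * (l j)\<^sup>2)"
  define I where "I \<epsilon> = enn2real (\<integral>\<^sup>+x. ennreal (F \<epsilon> x) \<partial>unit_measure)" for \<epsilon>
  note [measurable] = u
  have a_meas [measurable]: "a k \<in> borel_measurable unit_measure" if "k \<in> {1..n}" for k
    using that unfolding a_def by measurable
  have sum_a_meas [measurable]: "(\<lambda>x. \<Sum>k=1..n. \<epsilon> k *\<^sub>R a k x) \<in> borel_measurable unit_measure" for \<epsilon>
    by (intro borel_measurable_sum borel_measurable_scaleR) auto
  have K0: "0 \<le> K" using t by (simp add: K_def sum_nonneg)
  \<comment> \<open>Truncation makes the sum bounded on a space of finite measure, so
    \<open>I \<epsilon>\<close> is the true integral. Here \<epsilon> is arbitrary, hence the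
    absolute values.\<close>
  have F_int: "(\<integral>\<^sup>+x. ennreal (F \<epsilon> x) \<partial>unit_measure) = ennreal (I \<epsilon>)" for \<epsilon>
  proof -
    have "norm (\<Sum>k=1..n. \<epsilon> k *\<^sub>R a k x) \<le> (\<Sum>k=1..n. \<bar>\<epsilon> k\<bar> * l 0)" for x
    proof (rule sum_norm_le)
      fix k
      have "norm (a k x) \<le> l 0" using l by (auto simp: a_def)
      then show "norm (\<epsilon> k *\<^sub>R a k x) \<le> \<bar>\<epsilon> k\<bar> * l 0"
        by (simp add: mult_left_mono)
    qed
    then have "F \<epsilon> x \<le> (\<Sum>k=1..n. \<bar>\<epsilon> k\<bar> * l 0)\<^sup>2" for x
      unfolding F_def by (intro power_mono) auto
    then have "(\<integral>\<^sup>+x. ennreal (F \<epsilon> x) \<partial>unit_measure) \<le> (\<integral>\<^sup>+x. ennreal ((\<Sum>k=1..n. \<bar>\<epsilon> k\<bar> * l 0)\<^sup>2) \<partial>unit_measure)"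
      by (intro nn_integral_mono ennreal_leI)
    also have "\<dots> < top"
      by (simp add: ennreal_mult_less_top unit_measure.emeasure_eq_measure)
    finally show ?thesis by (simp add: I_def)
  qed
  have dr_le: "decreasing_rearrangement (\<lambda>x. \<Sum>k=1..n. \<epsilon> k *\<^sub>R u k x) t powr r \<le> (2 / t) powr (r / 2) * I \<epsilon> powr (r / 2)"
    for \<epsilon>
  proof -
    have meas [measurable]: "(\<lambda>x. \<Sum>k=1..n. \<epsilon> k *\<^sub>R u k x) \<in> borel_measurable unit_measure"
      by (intro borel_measurable_sum borel_measurable_scaleR) auto
    have "measure unit_measure {x \<in> {0<..<1}. (\<Sum>k=1..n. \<epsilon> k *\<^sub>R u k x) \<noteq> (\<Sum>k=1..n. \<epsilon> k *\<^sub>R a k x)}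
        \<le> measure unit_measure (\<Union>k\<in>{1..n}. {x \<in> {0<..<1}. l 0 < norm (u k x)})"
    proof (rule unit_measure.finite_measure_mono)
      show "{x \<in> {0<..<1}. (\<Sum>k=1..n. \<epsilon> k *\<^sub>R u k x) \<noteq> (\<Sum>k=1..n. \<epsilon> k *\<^sub>R a k x)}
          \<subseteq> (\<Union>k\<in>{1..n}. {x \<in> {0<..<1}. l 0 < norm (u k x)})"
        by (rule subsetI, rule ccontr) (auto simp: a_def intro!: sum.cong)
      show "(\<Union>k\<in>{1..n}. {x \<in> {0<..<1}. l 0 < norm (u k x)}) \<in> sets unit_measure"
        using sets_norm_greater[OF u] by (intro sets.finite_UN) auto
    qed
    also have "\<dots> \<le> (\<Sum>k=1..n. measure unit_measure {x \<in> {0<..<1}. l 0 < norm (u k x)})"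
      using sets_norm_greater[OF u] by (intro measure_UNION_le) auto
    also have "\<dots> \<le> (\<Sum>k=1..n. t / (2 * real n))"
      using dist[of _ 0] by (intro sum_mono) (auto simp: distribution_def)
    also have "\<dots> = t / 2" using n by simp
    finally have "decreasing_rearrangement (\<lambda>x. \<Sum>k=1..n. \<epsilon> k *\<^sub>R u k x) t \<le> sqrt (2 * I \<epsilon> / t)"
      using t F_int[of \<epsilon>]
      by (intro decreasing_rearrangement_le_L2[OF meas sum_a_meas[of \<epsilon>]]) (auto simp: F_def I_def)
    then have "decreasing_rearrangement (\<lambda>x. \<Sum>k=1..n. \<epsilon> k *\<^sub>R u k x) t powr r \<le> sqrt (2 * I \<epsilon> / t) powr r"
      using r t meas by (intro powr_mono2 decreasing_rearrangement_nonneg) auto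
    also have "\<dots> = (2 / t * I \<epsilon>) powr (r / 2)"
      using t by (simp add: powr_half_sqrt[symmetric] powr_powr I_def)
    also have "\<dots> = (2 / t) powr (r / 2) * I \<epsilon> powr (r / 2)"
      using t by (subst powr_mult) (auto simp: I_def)
    finally show ?thesis .
  qed
  \<comment> \<open>Minkowski's inequality with s = r/2 and W = 2^n C; Khinchine's inequality at
    each x supplies the pointwise hypothesis.\<close>
  have "(\<Sum>\<epsilon>\<in>?E. I \<epsilon> powr (r / 2)) \<le> 2 ^ n * C * K powr (r / 2)"
    unfolding I_def
  proof (rule Minkowski_powr_sum)
    show "N \<in> borel_measurable unit_measure"
      unfolding N_def by measurable
    show "0 \<le> N x" for x by (auto simp: N_def intro!: sum_nonneg)
    show "(\<Sum>\<epsilon>\<in>?E. F \<epsilon> x powr (r / 2)) \<le> 2 ^ n * C * N x powr (r / 2)" for x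
    proof -
      have "(\<Sum>\<epsilon>\<in>?E. F \<epsilon> x powr (r / 2)) = (\<Sum>\<epsilon>\<in>?E. norm (\<Sum>k=1..n. \<epsilon> k *\<^sub>R a k x) powr r)"
        unfolding F_def by (intro sum.cong refl) (simp add: powr_powr flip: powr_numeral)
      also have "\<dots> \<le> 2 ^ n * (C * (\<Sum>k=1..n. (norm (a k x))\<^sup>2) powr (r / 2))"
        by (rule C)
      also have "\<dots> \<le> 2 ^ n * (C * N x powr (r / 2))"
      proof -
        have "(norm (a k x))\<^sup>2 \<le> (\<Sum>j<J. (l j)\<^sup>2 * of_bool (l (Suc j) < norm (u k x)))" for k
        proof (cases "l 0 < norm (u k x)")
          case False
          then show ?thesis
            using square_le_sum_levels[of "norm (u k x)" l J] l by (simp add: a_def)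
        qed (auto simp: a_def intro!: sum_nonneg)
        then have "(\<Sum>k=1..n. (norm (a k x))\<^sup>2) \<le> N x"
          unfolding N_def by (intro sum_mono)
        then show ?thesis
          using C r by (intro mult_left_mono powr_mono2 sum_nonneg) auto
      qed
      finally show ?thesis by simp
    qed
    have dist_int: "(\<integral>\<^sup>+x. ennreal ((l j)\<^sup>2 * of_bool (l (Suc j) < norm (u k x))) \<partial>unit_measure)
        \<le> ennreal ((l j)\<^sup>2 * (2 ^ Suc j * (t / (2 * real n))))" if "k \<in> {1..n}" for j k
    proof -
      have "(\<integral>\<^sup>+x. ennreal ((l j)\<^sup>2 * of_bool (l (Suc j) < norm (u k x))) \<partial>unit_measure)
          = (\<integral>\<^sup>+x. ennreal ((l j)\<^sup>2) * indicator {x \<in> {0<..<1}. l (Suc j) < norm (u k x)} x \<partial>unit_measure)"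
        by (intro nn_integral_cong) (auto simp: indicator_def)
      also have "\<dots> = ennreal ((l j)\<^sup>2) * emeasure unit_measure {x \<in> {0<..<1}. l (Suc j) < norm (u k x)}"
        using sets_norm_greater[OF u[OF that]] by (intro nn_integral_cmult_indicator)
      also have "\<dots> = ennreal ((l j)\<^sup>2 * distribution (u k) (l (Suc j)))"
        by (simp add: unit_measure.emeasure_eq_measure distribution_def ennreal_mult)
      also have "\<dots> \<le> ennreal ((l j)\<^sup>2 * (2 ^ Suc j * (t / (2 * real n))))"
        using dist[OF that, of "Suc j"] by (intro ennreal_leI mult_left_mono) auto
      finally show ?thesis .
    qed
    have "(\<integral>\<^sup>+x. ennreal (N x) \<partial>unit_measure)
        = (\<Sum>k=1..n. \<Sum>j<J. \<integral>\<^sup>+x. ennreal ((l j)\<^sup>2 * of_bool (l (Suc j) < norm (u k x))) \<partial>unit_measure)"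
    proof -
      have "(\<integral>\<^sup>+x. ennreal (N x) \<partial>unit_measure)
          = (\<integral>\<^sup>+x. (\<Sum>k=1..n. \<Sum>j<J. ennreal ((l j)\<^sup>2 * of_bool (l (Suc j) < norm (u k x)))) \<partial>unit_measure)"
      proof (intro nn_integral_cong)
        fix x
        have "(\<Sum>j<J. ennreal ((l j)\<^sup>2 * of_bool (l (Suc j) < norm (u k x))))
            = ennreal (\<Sum>j<J. (l j)\<^sup>2 * of_bool (l (Suc j) < norm (u k x)))" for k
          by (rule sum_ennreal) auto
        then show "ennreal (N x) = (\<Sum>k=1..n. \<Sum>j<J. ennreal ((l j)\<^sup>2 * of_bool (l (Suc j) < norm (u k x))))"
          by (simp only: N_def) (rule sum_ennreal[symmetric], auto intro!: sum_nonneg)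
      qed
      also have "\<dots> = (\<Sum>k=1..n. \<integral>\<^sup>+x. (\<Sum>j<J. ennreal ((l j)\<^sup>2 * of_bool (l (Suc j) < norm (u k x)))) \<partial>unit_measure)"
        by (intro nn_integral_sum) measurable
      also have "\<dots> = (\<Sum>k=1..n. \<Sum>j<J. \<integral>\<^sup>+x. ennreal ((l j)\<^sup>2 * of_bool (l (Suc j) < norm (u k x))) \<partial>unit_measure)"
        by (intro sum.cong refl nn_integral_sum) measurable
      finally show ?thesis .
    qed
    also have "\<dots> \<le> (\<Sum>k=1..n. \<Sum>j<J. ennreal ((l j)\<^sup>2 * (2 ^ Suc j * (t / (2 * real n)))))"
      by (intro sum_mono dist_int)
    also have "\<dots> = ennreal (\<Sum>k=1..n. \<Sum>j<J. (l j)\<^sup>2 * (2 ^ Suc j * (t / (2 * real n))))"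
    proof -
      have "(\<Sum>j<J. ennreal ((l j)\<^sup>2 * (2 ^ Suc j * (t / (2 * real n)))))
          = ennreal (\<Sum>j<J. (l j)\<^sup>2 * (2 ^ Suc j * (t / (2 * real n))))"
        using t by (intro sum_ennreal) auto
      then show ?thesis
        using t by (simp only:) (rule sum_ennreal, auto intro!: sum_nonneg)
    qed
    also have "(\<Sum>k=1..n. \<Sum>j<J. (l j)\<^sup>2 * (2 ^ Suc j * (t / (2 * real n)))) = K"
      using n by (simp add: K_def sum_distrib_left field_simps)
    finally show "(\<integral>\<^sup>+x. ennreal (N x) \<partial>unit_measure) \<le> ennreal K" .
  qed (use r C K0 finite_signs[of n] in \<open>auto simp: F_def\<close>)
  then have "(2 / t) powr (r / 2) * (\<Sum>\<epsilon>\<in>?E. I \<epsilon> powr (r / 2)) \<le> (2 / t) powr (r / 2) * (2 ^ n * C * K powr (r / 2))"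
    by (intro mult_left_mono) auto
  moreover have "(\<Sum>\<epsilon>\<in>?E. decreasing_rearrangement (\<lambda>x. \<Sum>k=1..n. \<epsilon> k *\<^sub>R u k x) t powr r)
      \<le> (2 / t) powr (r / 2) * (\<Sum>\<epsilon>\<in>?E. I \<epsilon> powr (r / 2))"
    unfolding sum_distrib_left by (intro sum_mono dr_le)
  \<comment> \<open>The 1/t of Chebyshev's inequality cancels the t in K.\<close>
  moreover have "(2 / t) powr (r / 2) * K powr (r / 2) = (2 * (\<Sum>j<J. 2 ^ j * (l j)\<^sup>2)) powr (r / 2)"
    using t K0 by (subst powr_mult[symmetric]) (auto simp: K_def)
  ultimately show ?thesis
    by (simp add: mult.left_commute mult.assoc)
qed

text \<open>The number of dyadic levels depends on t; passing to the series removes it from the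
  bound, which can then be integrated in t. The outer exponent r/q prepares the second use of
  Minkowski's inequality.\<close>

lemma sum_signs_rearrangement_le_series:
  fixes u :: "nat \<Rightarrow> real \<Rightarrow> 'a::euclidean_space" and v :: "real \<Rightarrow> 'a"
  assumes \<theta>: "1 < \<theta>" and q: "0 < q" and r: "2 \<le> r"
    and C: "0 < C" "\<And>x :: nat \<Rightarrow> 'a. (\<Sum>\<epsilon>\<in>{1..n} \<rightarrow>\<^sub>E {-1, 1}. norm (\<Sum>k=1..n. \<epsilon> k *\<^sub>R x k) powr r)
      \<le> 2 ^ n * (C * (\<Sum>k=1..n. (norm (x k))\<^sup>2) powr (r / 2))"
    and K: "K = C powr (q / r) * 2 powr (q / 2) * (\<theta> / (\<theta> - 1)) powr (q / 2)"
    and u: "\<And>k. k \<ge> 1 \<Longrightarrow> u k \<in> borel_measurable unit_measure"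
    and v: "v \<in> borel_measurable unit_measure"
    and uv: "\<And>k t. k \<ge> 1 \<Longrightarrow> t > 0 \<Longrightarrow> decreasing_rearrangement (u k) t \<le> decreasing_rearrangement v t"
    and n: "0 < n" and t: "0 < t"
  shows "(\<Sum>\<epsilon>\<in>{1..n} \<rightarrow>\<^sub>E {-1, 1}. decreasing_rearrangement (\<lambda>x. \<Sum>k=1..n. \<epsilon> k *\<^sub>R u k x) t powr r)
    \<le> 2 ^ n * (K * (\<Sum>j. (2 * \<theta>) powr (q / 2 * real j) *
         decreasing_rearrangement v (2 ^ j / (2 * real n) * t) powr q)) powr (r / q)"
proof -
  define l where "l j = decreasing_rearrangement v (2 ^ j / (2 * real n) * t)" for j
  have pos: "0 < 2 ^ j / (2 * real n) * t" for j using n t by simp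
  have l0: "0 \<le> l j" for j
    unfolding l_def by (intro decreasing_rearrangement_nonneg v pos)
  obtain J where J: "2 * real n / t < 2 ^ J"
    using real_arch_pow[of 2 "2 * real n / t"] by auto
  have lJ: "l j = 0" if "J \<le> j" for j
  proof -
    have "(2 :: real) ^ J \<le> 2 ^ j" using that by (simp add: power_increasing)
    with J have "2 * real n / t < 2 ^ j" by linarith
    then show ?thesis
      unfolding l_def using n t by (intro decreasing_rearrangement_eq_0 v) (simp add: field_simps)
  qed
  let ?S = "\<Sum>j<J. 2 ^ j * (l j)\<^sup>2"
  let ?T = "\<Sum>j. (2 * \<theta>) powr (q / 2 * real j) * l j powr q"
  have S0: "0 \<le> ?S" by (intro sum_nonneg) auto
  have T: "?S powr (q / 2) \<le> (\<theta> / (\<theta> - 1)) powr (q / 2) * ?T"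
  proof -
    have "?S powr (q / 2) \<le> (\<theta> / (\<theta> - 1)) powr (q / 2) * (\<Sum>j<J. (\<theta> ^ j * (2 ^ j * (l j)\<^sup>2)) powr (q / 2))"
      using \<theta> q by (intro sum_powr_le_weighted) auto
    also have "(\<Sum>j<J. (\<theta> ^ j * (2 ^ j * (l j)\<^sup>2)) powr (q / 2))
        = (\<Sum>j<J. (2 * \<theta>) powr (q / 2 * real j) * l j powr q)"
    proof (intro sum.cong refl)
      fix j
      have "(\<theta> ^ j * (2 ^ j * (l j)\<^sup>2)) powr (q / 2) = ((2 * \<theta>) ^ j * (l j)\<^sup>2) powr (q / 2)"
        by (simp add: power_mult_distrib mult_ac)
      also have "\<dots> = ((2 * \<theta>) ^ j) powr (q / 2) * ((l j)\<^sup>2) powr (q / 2)"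
        by (rule powr_mult)
      also have "((2 * \<theta>) ^ j) powr (q / 2) = (2 * \<theta>) powr (q / 2 * real j)"
        using \<theta> by (subst powr_realpow[symmetric]) (simp_all add: powr_powr mult.commute)
      also have "((l j)\<^sup>2) powr (q / 2) = l j powr q"
        using l0[of j] by (simp add: powr_powr flip: powr_numeral)
      finally show "(\<theta> ^ j * (2 ^ j * (l j)\<^sup>2)) powr (q / 2) = (2 * \<theta>) powr (q / 2 * real j) * l j powr q" .
    qed
    also have "\<dots> \<le> ?T"
      using lJ by (intro sum_le_suminf summable_finite[of "{..<J}"]) (auto simp: not_less)
    finally show ?thesis
      by (simp add: mult_left_mono)
  qed
  have "(\<Sum>\<epsilon>\<in>{1..n} \<rightarrow>\<^sub>E {-1, 1}. decreasing_rearrangement (\<lambda>x. \<Sum>k=1..n. \<epsilon> k *\<^sub>R u k x) t powr r)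
      \<le> 2 ^ n * C * (2 * ?S) powr (r / 2)"
  proof (rule sum_signs_rearrangement_le)
    fix k j assume k: "k \<in> {1..n}"
    \<comment> \<open>Domination passes from rearrangements to level sets:
      \<open>distribution\<close> is antitone, and at the value of the rearrangement of
      \<open>u k\<close> at s it is at most s.\<close>
    have "distribution (u k) (l j) \<le> distribution (u k) (decreasing_rearrangement (u k) (2 ^ j / (2 * real n) * t))"
      unfolding l_def using k u uv pos by (intro distribution_antimono) auto
    also have "\<dots> \<le> 2 ^ j / (2 * real n) * t"
      using k u pos by (intro distribution_decreasing_rearrangement) auto
    finally show "distribution (u k) (l j) \<le> 2 ^ j * (t / (2 * real n))" by simp
  qed (use u n t r l0 lJ C in auto)
  also have "\<dots> = 2 ^ n * (C powr (q / r) * 2 powr (q / 2) * ?S powr (q / 2)) powr (r / q)"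
    using S0 C q r by (simp add: powr_mult powr_powr)
  also have "\<dots> \<le> 2 ^ n * (C powr (q / r) * 2 powr (q / 2) * ((\<theta> / (\<theta> - 1)) powr (q / 2) * ?T)) powr (r / q)"
    using T q r by (intro mult_left_mono powr_mono2) auto
  finally show ?thesis
    by (simp add: K l_def mult.assoc)
qed

section \<open>Averages of Lorentz norms\<close>

text \<open>The cut-off gives an integrand on the whole line, to which affine substitution over
  \<open>lborel\<close> applies.\<close>

definition lorentz_density :: "real \<Rightarrow> real \<Rightarrow> (real \<Rightarrow> 'a::real_normed_vector) \<Rightarrow> real \<Rightarrow> real" where
  "lorentz_density p q f t = (t powr (1 / p) * decreasing_rearrangement f t) powr q / t * indicator {0<..} t"

lemma lorentz_integral_altdef:
  "lorentz_integral p q f = (\<integral>\<^sup>+t. ennreal (lorentz_density p q f t) \<partial>lborel)"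
  unfolding lorentz_integral_def lorentz_density_def
  by (intro nn_integral_cong) (auto simp: indicator_def)

lemma lorentz_density_nonneg: "0 \<le> lorentz_density p q f t"
  by (auto simp: lorentz_density_def indicator_def)

lemma borel_measurable_lorentz_density [measurable]:
  assumes "f \<in> borel_measurable unit_measure"
  shows "lorentz_density p q f \<in> borel_measurable borel"
proof -
  note [measurable] = borel_measurable_decreasing_rearrangement[OF assms]
  have "lorentz_density p q f = (\<lambda>t. (t powr (1 / p) * (decreasing_rearrangement f t * indicator {0<..} t)) powr q / t
      * indicator {0<..} t)"
    by (auto simp: lorentz_density_def fun_eq_iff indicator_def)
  then show ?thesis by simp
qed

lemma lorentz_density_eq_0:
  assumes "f \<in> borel_measurable unit_measure" "1 \<le> t"
  shows "lorentz_density p q f t = 0"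
  using assms by (simp add: lorentz_density_def decreasing_rearrangement_eq_0)

lemma lorentz_density_pos:
  assumes "f \<in> borel_measurable unit_measure" "0 < t"
  shows "lorentz_density p q f t = t powr (q / p - 1) * decreasing_rearrangement f t powr q"
  using assms decreasing_rearrangement_nonneg[OF assms]
  by (simp add: lorentz_density_def powr_mult powr_powr powr_diff)

section \<open>The Lorentz integral near 0\<close>

text \<open>Real-valued so that it can be a coefficient of a real series; by
  \<open>ennreal_lorentz_head\<close> nothing is lost on the space.\<close>

definition lorentz_head :: "real \<Rightarrow> real \<Rightarrow> (real \<Rightarrow> 'a::real_normed_vector) \<Rightarrow> real \<Rightarrow> real" where
  "lorentz_head p q f a = enn2real (\<integral>\<^sup>+t. ennreal (lorentz_density p q f t * indicator {..<a} t) \<partial>lborel)"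

lemma lorentz_head_integral_le:
  "(\<integral>\<^sup>+t. ennreal (lorentz_density p q f t * indicator {..<a} t) \<partial>lborel) \<le> lorentz_integral p q f"
  unfolding lorentz_integral_altdef
  by (intro nn_integral_mono ennreal_leI) (auto simp: indicator_def lorentz_density_nonneg)

lemma ennreal_lorentz_head:
  assumes "f \<in> lorentz_space p q"
  shows "ennreal (lorentz_head p q f a) = (\<integral>\<^sup>+t. ennreal (lorentz_density p q f t * indicator {..<a} t) \<partial>lborel)"
proof -
  have "lorentz_integral p q f < top" using assms by (simp add: lorentz_space_def)
  then show ?thesis
    unfolding lorentz_head_def
    by (intro ennreal_enn2real le_less_trans[OF lorentz_head_integral_le])
qed

lemma lorentz_head_bounds:
  assumes "f \<in> lorentz_space p q"
  shows "0 \<le> lorentz_head p q f a" "lorentz_head p q f a \<le> enn2real (lorentz_integral p q f)"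
  using assms unfolding lorentz_head_def
  by (auto simp: lorentz_space_def intro!: enn2real_mono lorentz_head_integral_le)

text \<open>Every t > 0 eventually lies beyond a n, and the full density is an integrable
  majorant.\<close>

lemma lorentz_head_tendsto_0:
  assumes f: "f \<in> lorentz_space p q" and a: "a \<longlonglongrightarrow> 0"
  shows "(\<lambda>n. lorentz_head p q f (a n)) \<longlonglongrightarrow> 0"
proof -
  have [measurable]: "f \<in> borel_measurable unit_measure"
    using f by (simp add: lorentz_space_def)
  have "(\<lambda>n. \<integral>\<^sup>+t. ennreal (lorentz_density p q f t * indicator {..<a n} t) \<partial>lborel)
      \<longlonglongrightarrow> (\<integral>\<^sup>+(t :: real). 0 \<partial>lborel)"
  proof (rule nn_integral_dominated_convergence[where w = "\<lambda>t. ennreal (lorentz_density p q f t)"])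
    show "(\<integral>\<^sup>+t. ennreal (lorentz_density p q f t) \<partial>lborel) < \<infinity>"
      using f by (simp add: lorentz_space_def flip: lorentz_integral_altdef)
    show "AE t in lborel. (\<lambda>n. ennreal (lorentz_density p q f t * indicator {..<a n} t)) \<longlonglongrightarrow> 0"
    proof (intro AE_I2)
      fix t :: real
      have "\<forall>\<^sub>F n in sequentially. ennreal (lorentz_density p q f t * indicator {..<a n} t) = 0"
      proof (cases "0 < t")
        case True
        with a have "\<forall>\<^sub>F n in sequentially. a n < t" by (rule order_tendstoD)
        then show ?thesis by eventually_elim simp
      qed (simp add: lorentz_density_def)
      then show "(\<lambda>n. ennreal (lorentz_density p q f t * indicator {..<a n} t)) \<longlonglongrightarrow> 0"
        by (rule tendsto_eventually)
    qed
    show "AE t in lborel. ennreal (lorentz_density p q f t * indicator {..<a n} t) \<le> ennreal (lorentz_density p q f t)" for n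
      by (intro AE_I2 ennreal_leI) (auto simp: indicator_def lorentz_density_nonneg)
  qed auto
  then show ?thesis
    unfolding lorentz_head_def by (intro tendsto_enn2real[where l = 0, simplified]) simp
qed

text \<open>Substitution s = a t, with Jacobian 1/a: an integral over t < 1 becomes a head up to
  a.\<close>

lemma nn_integral_lorentz_density_scale:
  assumes f: "f \<in> lorentz_space p q" and a: "0 < a"
  shows "(\<integral>\<^sup>+t. ennreal (lorentz_density p q f (a * t) * indicator {..<1} t) \<partial>lborel)
    = ennreal (lorentz_head p q f a / a)"
proof -
  have [measurable]: "f \<in> borel_measurable unit_measure"
    using f by (simp add: lorentz_space_def)
  let ?I = "\<integral>\<^sup>+t. ennreal (lorentz_density p q f (a * t) * indicator {..<1} t) \<partial>lborel"
  have "ennreal (lorentz_head p q f a)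
      = ennreal \<bar>a\<bar> * (\<integral>\<^sup>+t. ennreal (lorentz_density p q f (0 + a * t) * indicator {..<a} (0 + a * t)) \<partial>lborel)"
    unfolding ennreal_lorentz_head[OF f] using a by (intro nn_integral_real_affine) auto
  also have "(\<lambda>t. indicator {..<a} (0 + a * t) :: real) = indicator {..<1}"
    using a by (auto simp: indicator_def fun_eq_iff)
  finally have *: "ennreal (lorentz_head p q f a) = ennreal a * ?I"
    using a by (simp add: indicator_def)
  have "ennreal (lorentz_head p q f a / a) = ennreal (1 / a) * (ennreal a * ?I)"
    using a lorentz_head_bounds[OF f] by (simp flip: * ennreal_mult)
  also have "\<dots> = ?I"
    using a by (simp add: mult.assoc[symmetric] flip: ennreal_mult)
  finally show ?thesis ..
qed

lemma borel_measurable_lorentz_space [measurable_dest]: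
  "f \<in> lorentz_space p q \<Longrightarrow> f \<in> borel_measurable unit_measure"
  by (simp add: lorentz_space_def)

lemma summable_lorentz_head:
  assumes "f \<in> lorentz_space p q" "0 < \<rho>" "\<rho> < 1"
  shows "summable (\<lambda>j. \<rho> ^ j * lorentz_head p q f (a j))"
proof (rule summable_comparison_test')
  show "summable (\<lambda>j. \<rho> ^ j * enn2real (lorentz_integral p q f))"
    using assms by (intro summable_mult2 summable_geometric) auto
  show "norm (\<rho> ^ j * lorentz_head p q f (a j)) \<le> \<rho> ^ j * enn2real (lorentz_integral p q f)" for j
    using assms lorentz_head_bounds[OF assms(1)] by (simp add: abs_mult mult_left_mono)
qed

text \<open>The r-th power of the norm is the integral to the power r/q, so Minkowski's inequality
  with s = r/q brings the average down to the densities at a fixed t.\<close>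

lemma sign_average_lorentz_norm_le:
  fixes u :: "nat \<Rightarrow> real \<Rightarrow> 'a::euclidean_space" and v :: "real \<Rightarrow> 'a"
  assumes q: "0 < q" "q \<le> r" and r: "2 \<le> r" and \<theta>: "1 < \<theta>"
    and C: "0 < C" "\<And>x :: nat \<Rightarrow> 'a. (\<Sum>\<epsilon>\<in>{1..n} \<rightarrow>\<^sub>E {-1, 1}. norm (\<Sum>k=1..n. \<epsilon> k *\<^sub>R x k) powr r)
      \<le> 2 ^ n * (C * (\<Sum>k=1..n. (norm (x k))\<^sup>2) powr (r / 2))"
    and K: "K = C powr (q / r) * 2 powr (q / 2) * (\<theta> / (\<theta> - 1)) powr (q / 2)"
    and \<rho>: "\<rho> = (2 * \<theta>) powr (q / 2) * 2 powr (- q / p)" "\<rho> < 1"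
    and u: "\<And>k. k \<ge> 1 \<Longrightarrow> u k \<in> lorentz_space p q"
    and v: "v \<in> lorentz_space p q"
    and uv: "\<And>k t. k \<ge> 1 \<Longrightarrow> t > 0 \<Longrightarrow> decreasing_rearrangement (u k) t \<le> decreasing_rearrangement v t"
    and n: "0 < n"
  shows "sign_average n (\<lambda>\<epsilon>. lorentz_norm p q (\<lambda>x. \<Sum>k=1..n. \<epsilon> k *\<^sub>R u k x) powr r)
    \<le> (K * (2 * real n) powr (q / p) * (\<Sum>j. \<rho> ^ j * lorentz_head p q v (2 ^ j / (2 * real n)))) powr (r / q)"
proof -
  have K0: "0 < K" using C \<theta> by (simp add: K)
  let ?E = "{1..n} \<rightarrow>\<^sub>E {-1, 1::real}"
  define a where "a j = 2 ^ j / (2 * real n)" for j :: nat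
  have a: "0 < a j" for j using n by (simp add: a_def)
  have u_meas [measurable]: "u k \<in> borel_measurable unit_measure" if "k \<ge> 1" for k
    using u[OF that] by (rule borel_measurable_lorentz_space)
  have v_meas [measurable]: "v \<in> borel_measurable unit_measure"
    using v by (rule borel_measurable_lorentz_space)
  define S where "S \<epsilon> x = (\<Sum>k=1..n. \<epsilon> k *\<^sub>R u k x)" for \<epsilon> x
  have S_meas: "S \<epsilon> \<in> borel_measurable unit_measure" for \<epsilon>
    unfolding S_def by (intro borel_measurable_sum borel_measurable_scaleR u_meas) auto
  \<comment> \<open>The power a_j^(1 - q/p) undoes the factor a_j^(q/p - 1) in the density of v at
    a_j t, so h j t is K t^(q/p - 1) times the j-th term of the series.\<close>
  define c where "c j = K * (2 * \<theta>) powr (q / 2 * real j) * a j powr (1 - q / p)" for j :: nat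
  have c: "0 \<le> c j" for j using K0 by (simp add: c_def)
  \<comment> \<open>Restricting to t < 1 loses nothing, as the density of the sum vanishes beyond;
    it is what turns full integrals of v into heads.\<close>
  define h where "h j t = c j * (lorentz_density p q v (a j * t) * indicator {..<1} t)" for j t
  have h0: "0 \<le> h j t" for j t by (simp add: h_def c lorentz_density_nonneg)
  have h_meas [measurable]: "h j \<in> borel_measurable borel" for j
    unfolding h_def using borel_measurable_lorentz_density[OF v_meas] by measurable
  have h_summable: "summable (\<lambda>j. h j t)" for t
  proof (cases "0 < t")
    case True
    obtain J where J: "2 * real n / t < 2 ^ J"
      using real_arch_pow[of 2 "2 * real n / t"] by auto
    have "h j t = 0" if "j \<notin> {..<J}" for j
    proof -
      have "(2 :: real) ^ J \<le> 2 ^ j" using that by (simp add: power_increasing)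
      with J have "2 * real n / t < 2 ^ j" by linarith
      then have "1 \<le> a j * t" using n True by (simp add: a_def field_simps)
      then show ?thesis by (simp add: h_def lorentz_density_eq_0[OF v_meas])
    qed
    then show ?thesis by (intro summable_finite[of "{..<J}"]) auto
  next
    case False
    then have "h j t = 0" for j
      using a[of j] by (simp add: h_def lorentz_density_def zero_less_mult_iff)
    then show ?thesis by simp
  qed
  define N where "N t = (\<Sum>j. h j t)" for t
  define T where "T = (\<Sum>j. \<rho> ^ j * lorentz_head p q v (a j))"
  have \<rho>0: "0 < \<rho>" unfolding \<rho>(1) using \<theta> by simp
  have head: "0 \<le> lorentz_head p q v (a j)" for j by (rule lorentz_head_bounds[OF v])
  have T_summable: "summable (\<lambda>j. \<rho> ^ j * lorentz_head p q v (a j))"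
    using v \<rho>0 \<rho>(2) by (rule summable_lorentz_head)
  have T0: "0 \<le> T" unfolding T_def using \<rho>0 head by (intro suminf_nonneg T_summable) auto
  \<comment> \<open>Division by a_j is the Jacobian. The resulting a_j^(-q/p) splits into
    (2n)^(q/p), the order of growth, and 2^(-jq/p), which together with (2\<theta>)^(jq/2) forms
    \<rho>^j.\<close>
  have c_div_a: "c j / a j = K * (2 * real n) powr (q / p) * \<rho> ^ j" for j
  proof -
    have pow: "\<rho> ^ j = (2 * \<theta>) powr (q / 2 * real j) * 2 powr (- q / p * real j)"
      using \<rho>0 \<theta> by (simp add: \<rho>(1) powr_mult powr_powr flip: powr_realpow)
    have "a j powr (1 - q / p) / a j = a j powr (- q / p)"
      using a[of j] powr_diff[of "a j" "1 - q / p" 1] by simp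
    also have "\<dots> = 2 powr (- q / p * real j) * (2 * real n) powr (q / p)"
      using n by (simp add: a_def powr_divide powr_powr powr_minus mult.commute divide_simps flip: powr_realpow)
    finally have "c j / a j = K * (2 * \<theta>) powr (q / 2 * real j) * (2 powr (- q / p * real j) * (2 * real n) powr (q / p))"
      unfolding c_def times_divide_eq_right[symmetric] by (rule arg_cong)
    then show ?thesis unfolding pow by (simp only: mult_ac)
  qed
  have N_int: "(\<integral>\<^sup>+t. ennreal (N t) \<partial>lborel) = ennreal (K * (2 * real n) powr (q / p) * T)"
  proof -
    have "(\<integral>\<^sup>+t. ennreal (N t) \<partial>lborel) = (\<integral>\<^sup>+t. (\<Sum>j. ennreal (h j t)) \<partial>lborel)"
      unfolding N_def by (intro nn_integral_cong suminf_ennreal2[symmetric] h0 h_summable)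
    also have "\<dots> = (\<Sum>j. \<integral>\<^sup>+t. ennreal (h j t) \<partial>lborel)"
      by (intro nn_integral_suminf) auto
    also have "\<dots> = (\<Sum>j. ennreal (K * (2 * real n) powr (q / p) * (\<rho> ^ j * lorentz_head p q v (a j))))"
    proof (intro suminf_cong)
      fix j
      note [measurable] = borel_measurable_lorentz_density[OF v_meas]
      have "(\<integral>\<^sup>+t. ennreal (h j t) \<partial>lborel)
          = ennreal (c j) * (\<integral>\<^sup>+t. ennreal (lorentz_density p q v (a j * t) * indicator {..<1} t) \<partial>lborel)"
        unfolding h_def using c by (simp add: ennreal_mult' lorentz_density_nonneg nn_integral_cmult)
      also have "\<dots> = ennreal (c j / a j * lorentz_head p q v (a j))"
        using c a[of j] head by (simp add: nn_integral_lorentz_density_scale[OF v] flip: ennreal_mult)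
      finally show "(\<integral>\<^sup>+t. ennreal (h j t) \<partial>lborel) = ennreal (K * (2 * real n) powr (q / p) * (\<rho> ^ j * lorentz_head p q v (a j)))"
        by (simp add: c_div_a mult.assoc)
    qed
    also have "\<dots> = ennreal (\<Sum>j. K * (2 * real n) powr (q / p) * (\<rho> ^ j * lorentz_head p q v (a j)))"
      using K0 \<rho>0 head by (intro suminf_ennreal2 summable_mult T_summable) auto
    also have "\<dots> = ennreal (K * (2 * real n) powr (q / p) * T)"
      unfolding T_def using T_summable by (subst suminf_mult) auto
    finally show ?thesis .
  qed
  have "(\<Sum>\<epsilon>\<in>?E. enn2real (\<integral>\<^sup>+t. ennreal (lorentz_density p q (S \<epsilon>) t) \<partial>lborel) powr (r / q))
      \<le> 2 ^ n * (K * (2 * real n) powr (q / p) * T) powr (r / q)"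
  proof (rule Minkowski_powr_sum)
    show "finite ?E" by (rule finite_signs)
    show "N \<in> borel_measurable lborel" unfolding N_def by measurable
    show N0: "0 \<le> N t" for t unfolding N_def by (intro suminf_nonneg h_summable h0)
    show "(\<Sum>\<epsilon>\<in>?E. lorentz_density p q (S \<epsilon>) t powr (r / q)) \<le> 2 ^ n * N t powr (r / q)" for t
    proof (cases "0 < t \<and> t < 1")
      case False
      then have "lorentz_density p q (S \<epsilon>) t = 0" for \<epsilon>
        using lorentz_density_eq_0[OF S_meas] by (cases "0 < t") (auto simp: lorentz_density_def)
      then show ?thesis by simp
    next
      case True
      then have t: "0 < t" "t < 1" by auto
      let ?G = "\<lambda>j. (2 * \<theta>) powr (q / 2 * real j) * decreasing_rearrangement v (a j * t) powr q"
      have "(\<Sum>\<epsilon>\<in>?E. lorentz_density p q (S \<epsilon>) t powr (r / q))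
          = (t powr (q / p - 1)) powr (r / q) * (\<Sum>\<epsilon>\<in>?E. decreasing_rearrangement (S \<epsilon>) t powr r)"
        using q t unfolding sum_distrib_left lorentz_density_pos[OF S_meas t(1)]
        by (intro sum.cong refl) (subst powr_mult, auto simp: powr_powr)
      also have "\<dots> \<le> (t powr (q / p - 1)) powr (r / q) * (2 ^ n * (K * (\<Sum>j. ?G j)) powr (r / q))"
        unfolding S_def a_def using u_meas uv n t
          by (intro mult_left_mono sum_signs_rearrangement_le_series[OF \<theta> q(1) r C K _ v_meas]) auto
      also have "\<dots> = 2 ^ n * (t powr (q / p - 1) * (K * (\<Sum>j. ?G j))) powr (r / q)"
        by (simp add: powr_mult mult_ac)
      also have "t powr (q / p - 1) * (K * (\<Sum>j. ?G j)) = N t"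
      proof -
        have h_eq: "h j t = t powr (q / p - 1) * K * ?G j" for j
        proof -
          have "a j * t > 0" using a t by simp
          then have "h j t = c j * ((a j * t) powr (q / p - 1) * decreasing_rearrangement v (a j * t) powr q)"
            using t unfolding h_def by (subst lorentz_density_pos[OF v_meas]) auto
          also have "(a j * t) powr (q / p - 1) = a j powr (q / p - 1) * t powr (q / p - 1)"
            by (rule powr_mult)
          finally show ?thesis
            using a[of j] by (simp add: c_def powr_diff field_simps)
        qed
        \<comment> \<open>Summability of ?G itself, needed to pull the constant out of the series,
          is recovered from that of h by cancelling a positive factor.\<close>
        have "summable (\<lambda>j. t powr (q / p - 1) * K * ?G j)"
          using h_summable[of t] unfolding h_eq .
        then have "summable ?G"
          by (subst (asm) summable_cmult_iff) (use K0 t in auto)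
        then show ?thesis
          unfolding N_def h_eq by (subst suminf_mult) (auto simp: mult.assoc)
      qed
      finally show ?thesis .
    qed
    show "lorentz_density p q (S \<epsilon>) \<in> borel_measurable lborel" for \<epsilon>
      using borel_measurable_lorentz_density[OF S_meas[of \<epsilon>]] by simp
    show "0 \<le> K * (2 * real n) powr (q / p) * T" using K0 T0 by simp
  qed (use q N_int in \<open>auto simp: lorentz_density_nonneg\<close>)
  then have "(\<Sum>\<epsilon>\<in>?E. lorentz_norm p q (S \<epsilon>) powr r) \<le> 2 ^ n * (K * (2 * real n) powr (q / p) * T) powr (r / q)"
    using q by (simp add: lorentz_norm_def lorentz_integral_altdef powr_powr)
  then have "sign_average n (\<lambda>\<epsilon>. lorentz_norm p q (S \<epsilon>) powr r) \<le> (K * (2 * real n) powr (q / p) * T) powr (r / q)"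
    by (simp add: sign_average_def field_simps)
  then show ?thesis
    by (simp add: S_def[abs_def] T_def a_def)
qed

theorem proposition3p2:
  fixes p q r :: real
    and u :: "nat \<Rightarrow> real \<Rightarrow> 'a::{real_normed_field, euclidean_space}"
    and v :: "real \<Rightarrow> 'a"
  assumes "0 < p" and "p < 2" and "0 < q"
    and "\<And>k. k \<ge> 1 \<Longrightarrow> u k \<in> lorentz_space p q"
    and "v \<in> lorentz_space p q"
    and "\<And>k t. k \<ge> 1 \<Longrightarrow> t > 0 \<Longrightarrow>
           decreasing_rearrangement (u k) t \<le> decreasing_rearrangement v t"
    and "r > max p (max q 2)"
  shows "(\<lambda>n. (sign_average n (\<lambda>\<epsilon>.
              lorentz_norm p q (\<lambda>x. \<Sum>k=1..n. \<epsilon> k *\<^sub>R u k x) powr r)) powr (1 / r))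
         \<in> o(\<lambda>n. real n powr (1 / p))"
proof -
  \<comment> \<open>Any \<open>\<theta>\<close> strictly between 1 and \<open>2 powr (2 / p - 1)\<close> would do: the upper bound gives \<open>\<rho> < 1\<close>.\<close>
  define \<theta> :: real where "\<theta> = 2 powr (1 / p - 1 / 2)"
  define \<rho> where "\<rho> = (2 * \<theta>) powr (q / 2) * 2 powr (- q / p)"
  have p: "1 / 2 < 1 / p" using assms by (simp add: field_simps)
  have \<theta>: "1 < \<theta>" using p by (simp add: \<theta>_def)
  \<comment> \<open>The exponent is negative because p < 2.\<close>
  have "\<rho> = 2 powr (q / 2 * (1 / 2 - 1 / p))"
    using assms by (simp add: \<rho>_def \<theta>_def powr_mult powr_powr algebra_simps add_divide_distrib flip: powr_add)
  also have "\<dots> < 2 powr 0"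
    using assms p by (intro powr_less_mono) (auto simp: mult_less_0_iff)
  finally have \<rho>1: "\<rho> < 1" by simp
  have \<rho>0: "0 < \<rho>" using \<theta> by (simp add: \<rho>_def)
  define A where "A n = sign_average n (\<lambda>\<epsilon>. lorentz_norm p q (\<lambda>x. \<Sum>k=1..n. \<epsilon> k *\<^sub>R u k x) powr r)" for n
  define T where "T n = (\<Sum>j. \<rho> ^ j * lorentz_head p q v (2 ^ j / (2 * real n)))" for n
  have qr: "q \<le> r" "2 \<le> r" using assms by auto
  have "0 < r" using qr by simp
  then obtain C where C: "0 < C" "\<And>n (x :: nat \<Rightarrow> 'a). (\<Sum>\<epsilon>\<in>{1..n} \<rightarrow>\<^sub>E {-1, 1}. norm (\<Sum>k=1..n. \<epsilon> k *\<^sub>R x k) powr r)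
      \<le> 2 ^ n * (C * (\<Sum>k=1..n. (norm (x k))\<^sup>2) powr (r / 2))"
    using khinchine_euclidean[of r, where 'a = 'a] by blast
  define K where "K = C powr (q / r) * 2 powr (q / 2) * (\<theta> / (\<theta> - 1)) powr (q / 2)"
  have A_le: "A n \<le> (K * (2 * real n) powr (q / p) * T n) powr (r / q)" if "0 < n" for n
    unfolding A_def T_def
    by (rule sign_average_lorentz_norm_le[OF assms(3) qr \<theta> C(1) C(2) K_def \<rho>_def \<rho>1 assms(4-6) that])
  \<comment> \<open>The limits of integration 2^j/(2n) do not tend to 0 uniformly in j; Tannery's
    theorem needs only the limit for each j and the summable bound \<rho>^j times the full integral
    of v.\<close>
  have T_lim: "T \<longlonglongrightarrow> 0"
  proof -
    have "(\<lambda>n. lorentz_head p q v (2 ^ j / (2 * real n))) \<longlonglongrightarrow> 0" for j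
      by (intro lorentz_head_tendsto_0 assms) (use lim_const_over_n[of "2 ^ j / 2"] in simp)
    then have "(\<lambda>n. \<Sum>j. \<rho> ^ j * lorentz_head p q v (2 ^ j / (2 * real n))) \<longlonglongrightarrow> (\<Sum>j::nat. 0)"
    proof (intro tannerys_theorem[THEN conjunct2, THEN conjunct2] always_eventually)
      show "summable (\<lambda>j. \<rho> ^ j * enn2real (lorentz_integral p q v))"
        using \<rho>0 \<rho>1 by (intro summable_mult2 summable_geometric) auto
      show "\<forall>x. case x of (j, n) \<Rightarrow> norm (\<rho> ^ j * lorentz_head p q v (2 ^ j / (2 * real n)))
          \<le> \<rho> ^ j * enn2real (lorentz_integral p q v)"
        using \<rho>0 lorentz_head_bounds[OF assms(5)] by (auto simp: abs_mult mult_left_mono)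
    qed (auto intro: tendsto_mult_right_zero)
    then show ?thesis by (simp add: T_def[abs_def])
  qed
  have T0: "0 \<le> T n" for n
    unfolding T_def using \<rho>0 lorentz_head_bounds[OF assms(5)]
    by (intro suminf_nonneg summable_lorentz_head[OF assms(5) \<rho>0 \<rho>1]) auto
  have A0: "0 \<le> A n" for n
    by (simp add: A_def sign_average_def sum_nonneg)
  have K0: "0 \<le> K" by (simp add: K_def)
  \<comment> \<open>The q-th root turns (2n)^(q/p) into 2^(1/p) n^(1/p), so the quotient keeps no
    power of n and all decay sits in T n.\<close>
  have le: "A n powr (1 / r) / real n powr (1 / p) \<le> 2 powr (1 / p) * (K * T n) powr (1 / q)" if n: "0 < n" for n
  proof -
    have "A n powr (1 / r) \<le> ((K * (2 * real n) powr (q / p) * T n) powr (r / q)) powr (1 / r)"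
      using A_le[OF n] A0 qr by (intro powr_mono2) auto
    also have "\<dots> = (K * (2 * real n) powr (q / p) * T n) powr (1 / q)"
      using qr by (simp add: powr_powr)
    also have "\<dots> = (K * T n) powr (1 / q) * ((2 * real n) powr (q / p)) powr (1 / q)"
      by (simp add: powr_mult mult_ac)
    also have "((2 * real n) powr (q / p)) powr (1 / q) = 2 powr (1 / p) * real n powr (1 / p)"
      using assms by (simp add: powr_powr powr_mult)
    finally show ?thesis using n by (simp add: field_simps)
  qed
  have "(\<lambda>n. A n powr (1 / r) / real n powr (1 / p)) \<longlonglongrightarrow> 0"
  proof (rule tendsto_sandwich[where f = "\<lambda>_. 0"])
    \<comment> \<open>The power is continuous at 0 along nonnegative values because 1/q > 0; hence
      the signs of K and T n.\<close>
    have "(\<lambda>n. (K * T n) powr (1 / q)) \<longlonglongrightarrow> 0 powr (1 / q)"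
      using assms K0 T0 by (intro tendsto_powr2 tendsto_mult_right_zero T_lim) auto
    then show "(\<lambda>n. 2 powr (1 / p) * (K * T n) powr (1 / q)) \<longlonglongrightarrow> 0"
      by (intro tendsto_mult_right_zero) simp
    show "\<forall>\<^sub>F n in sequentially. A n powr (1 / r) / real n powr (1 / p) \<le> 2 powr (1 / p) * (K * T n) powr (1 / q)"
      using eventually_gt_at_top[of 0] by eventually_elim (rule le)
  qed auto
  then have "(\<lambda>n. A n powr (1 / r)) \<in> o(\<lambda>n. real n powr (1 / p))"
    by (intro smalloI_tendsto) (auto intro: eventually_mono[OF eventually_gt_at_top[of 0]])
  then show ?thesis by (simp add: A_def)
qed

end
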